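(* Suppose $A$ is elemental and $\mathfrak g(A)$ has finite growth. Then $A$, and every matrix $A'$ obtained from $A$ by a finite sequence of odd reflections (at isotropic indices, regular or singular), satisfies, after multiplying rows by suitable nonzero scalars, the conditions: (C1) $a_{ii}\in\{0,2\}$ for all $i$; (C2) if $a_{ii}=0$ then $p(i)=1$; (C3) if $a_{ii}=2$ then $a_{ij}\in2^{p(i)}\mathbb Z_{\le0}$ for all $j\neq i$; (C4) if $a_{ij}=0$ and $a_{ji}\neq0$ then $a_{ii}=0$ (with the corresponding parities of $A'$).
   Context: Let $I=\{1,\dots,n\}$, let $A=(a_{ij})_{i,j\in I}$ be a complex $n\times n$ matrix and $p:I\to\mathbb Z_2$ a parity function. Fix a complex vector space $\mathfrak h$ of dimension $n+\operatorname{corank}(A)$, linearly independent $\alpha_1,\dots,\alpha_n\in\mathfrak h^*$ and $h_1,\dots,h_n\in\mathfrak h$ with $\alpha_j(h_i)=a_{ij}$. Let $\bar{\mathfrak g}(A)$ be the Lie superalgebra generated by $\mathfrak h$ (even, abelian) and elements $X_i,Y_i$ ($i\in I$) of parity $p(i)$ subject to $[h,X_i]=\alpha_i(h)X_i$, $[h,Y_i]=-\alpha_i(h)Y_i$, $[X_i,Y_j]=\delta_{ij}h_i$. The contragredient Lie superalgebra $\mathfrak g(A)$ is the quotient of $\bar{\mathfrak g}(A)$ by the unique maximal ideal meeting $\mathfrak h$ trivially. Principal grading: $\deg\mathfrak h=0$, $\deg X_i=1$, $\deg Y_i=-1$; finite growth means $\dim\mathfrak g_m$ is bounded by a polynomial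 in $|m|$. $A$ is elemental if it has no zero row. Odd reflection: an index $k$ with $a_{kk}=0$, $p(k)=1$ is called isotropic. The odd reflection at an isotropic $k$ produces $(A',p')$ defined, for $i,j\ne k$, by $a'_{kk}=a_{kk}$, $a'_{kj}=a_{kj}$, $a'_{ik}=-a_{ki}a_{ik}$, and $a'_{ij}=a_{ij}$ if $a_{ik}=a_{ki}=0$; $a'_{ij}=a_{ki}a_{ij}$ if ($a_{ik}\ne0$ or $a_{ki}\neq0$) and $a_{kj}=a_{jk}=0$; $a'_{ij}=a_{ki}a_{ij}+a_{kj}a_{ik}+a_{ki}a_{ik}$ if ($a_{ik}\ne0$ or $a_{ki}\ne 0$) and ($a_{jk}\ne0$ or $a_{kj}\ne0$); parities $p'(k)=1$, $p'(i)=p(i)+1$ if $a_{ik}\ne0$ or $a_{ki}\ne0$, and $p'(i)=p(i)$ otherwise. $A'$ is considered up to multiplying its rows by nonzero scalars. An isotropic $k$ is regular if for all $j\neq k$, $a_{kj}=0\Rightarrow a_{jk}=0$, and singular otherwise. *)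

theory Defs
  imports Complex_Main
begin

text \<open>Matrices are indexed by a finite type 'i (playing the role of I = {1..n}).
  Parities are booleans: True = odd (1 in Z_2), False = even.\<close>

definition rows_independent :: "('i \<Rightarrow> 'i \<Rightarrow> complex) \<Rightarrow> 'i set \<Rightarrow> bool" where
  "rows_independent A J \<longleftrightarrow>
     (\<forall>c :: 'i \<Rightarrow> complex. (\<forall>j. (\<Sum>i\<in>J. c i * A i j) = 0) \<longrightarrow> (\<forall>i\<in>J. c i = 0))"

definition mat_rank :: "('i::finite \<Rightarrow> 'i \<Rightarrow> complex) \<Rightarrow> nat" where
  "mat_rank A = Max {card J | J. rows_independent A J}"

definition mat_corank :: "('i::finite \<Rightarrow> 'i \<Rightarrow> complex) \<Rightarrow> nat" where
  "mat_corank A = card (UNIV :: 'i set) - mat_rank A"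

definition elemental :: "('i \<Rightarrow> 'i \<Rightarrow> complex) \<Rightarrow> bool" where
  "elemental A \<longleftrightarrow> (\<forall>i. \<exists>j. A i j \<noteq> 0)"

definition isotropic :: "('i \<Rightarrow> 'i \<Rightarrow> complex) \<Rightarrow> ('i \<Rightarrow> bool) \<Rightarrow> 'i \<Rightarrow> bool" where
  "isotropic A p k \<longleftrightarrow> A k k = 0 \<and> p k"

definition odd_refl_mat :: "('i \<Rightarrow> 'i \<Rightarrow> complex) \<Rightarrow> 'i \<Rightarrow> 'i \<Rightarrow> 'i \<Rightarrow> complex" where
  "odd_refl_mat A k i j =
     (if i = k then A k j
      else if j = k then - (A k i * A i k)
      else if A i k = 0 \<and> A k i = 0 then A i j
      else if A k j = 0 \<and> A j k = 0 then A k i * A i j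
      else A k i * A i j + A k j * A i k + A k i * A i k)"

definition odd_refl_par :: "('i \<Rightarrow> 'i \<Rightarrow> complex) \<Rightarrow> ('i \<Rightarrow> bool) \<Rightarrow> 'i \<Rightarrow> 'i \<Rightarrow> bool" where
  "odd_refl_par A p k i =
     (if i = k then True
      else if A i k \<noteq> 0 \<or> A k i \<noteq> 0 then \<not> p i
      else p i)"

inductive odd_refl_reach ::
  "('i \<Rightarrow> 'i \<Rightarrow> complex) \<Rightarrow> ('i \<Rightarrow> bool) \<Rightarrow> ('i \<Rightarrow> 'i \<Rightarrow> complex) \<Rightarrow> ('i \<Rightarrow> bool) \<Rightarrow> bool"
  for A p where
  refl: "odd_refl_reach A p A p"
| step: "odd_refl_reach A p B q \<Longrightarrow> isotropic B q k \<Longrightarrow>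
         odd_refl_reach A p (odd_refl_mat B k) (odd_refl_par B q k)"

definition conds_C1_C4 :: "('i \<Rightarrow> 'i \<Rightarrow> complex) \<Rightarrow> ('i \<Rightarrow> bool) \<Rightarrow> bool" where
  "conds_C1_C4 B p \<longleftrightarrow>
     (\<forall>i. B i i = 0 \<or> B i i = 2) \<and>
     (\<forall>i. B i i = 0 \<longrightarrow> p i) \<and>
     (\<forall>i. B i i = 2 \<longrightarrow> (\<forall>j. j \<noteq> i \<longrightarrow>
          (\<exists>m::nat. B i j = - (of_nat m * (if p i then 2 else 1))))) \<and>
     (\<forall>i j. B i j = 0 \<and> B j i \<noteq> 0 \<longrightarrow> B i i = 0)"

definition satisfies_C1_C4_up_to_rows :: "('i \<Rightarrow> 'i \<Rightarrow> complex) \<Rightarrow> ('i \<Rightarrow> bool) \<Rightarrow> bool" where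
  "satisfies_C1_C4_up_to_rows A p \<longleftrightarrow>
     (\<exists>r :: 'i \<Rightarrow> complex. (\<forall>i. r i \<noteq> 0) \<and> conds_C1_C4 (\<lambda>i j. r i * A i j) p)"

definition par_part :: "'v set \<Rightarrow> 'v set \<Rightarrow> bool \<Rightarrow> 'v set" where
  "par_part V0 V1 b = (if b then V1 else V0)"

definition super_sign :: "bool \<Rightarrow> bool \<Rightarrow> complex" where
  "super_sign a b = (if a \<and> b then -1 else 1)"

definition lie_superalgebra ::
  "(complex \<Rightarrow> 'v::ab_group_add \<Rightarrow> 'v) \<Rightarrow> ('v \<Rightarrow> 'v \<Rightarrow> 'v) \<Rightarrow> 'v set \<Rightarrow> 'v set \<Rightarrow> bool" where
  "lie_superalgebra sc br V0 V1 \<longleftrightarrow>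
     vector_space sc \<and>
     module.subspace sc V0 \<and> module.subspace sc V1 \<and> V0 \<inter> V1 = {0} \<and>
     (\<forall>v. \<exists>a\<in>V0. \<exists>b\<in>V1. v = a + b) \<and>
     (\<forall>x y z. br (x + y) z = br x z + br y z) \<and>
     (\<forall>x y z. br x (y + z) = br x y + br x z) \<and>
     (\<forall>c x y. br (sc c x) y = sc c (br x y)) \<and>
     (\<forall>c x y. br x (sc c y) = sc c (br x y)) \<and>
     (\<forall>a b x y. x \<in> par_part V0 V1 a \<longrightarrow> y \<in> par_part V0 V1 b \<longrightarrow>
        br x y \<in> par_part V0 V1 (a \<noteq> b)) \<and>
     (\<forall>a b x y. x \<in> par_part V0 V1 a \<longrightarrow> y \<in> par_part V0 V1 b \<longrightarrow>
        br x y = - sc (super_sign a b) (br y x)) \<and>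
     (\<forall>a b x y z. x \<in> par_part V0 V1 a \<longrightarrow> y \<in> par_part V0 V1 b \<longrightarrow>
        br x (br y z) = br (br x y) z + sc (super_sign a b) (br y (br x z)))"

definition lie_ideal :: "(complex \<Rightarrow> 'v::ab_group_add \<Rightarrow> 'v) \<Rightarrow> ('v \<Rightarrow> 'v \<Rightarrow> 'v) \<Rightarrow> 'v set \<Rightarrow> bool" where
  "lie_ideal sc br J \<longleftrightarrow> module.subspace sc J \<and> (\<forall>x\<in>J. \<forall>y. br x y \<in> J \<and> br y x \<in> J)"

text \<open>The data (sc, br, V0, V1, H, alpha, hh, X, Y) realise g(A): H is the Cartan subalgebra
  (a subspace of the even part, abelian, of dimension n + corank A), alpha i are linearly
  independent linear functionals on H, hh i \<in> H with alpha j (hh i) = a_ij, the algebra is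
  generated by H and the X i, Y i subject to the defining relations, and it has no nonzero
  ideal meeting H trivially.  (Such an algebra is isomorphic to the quotient of the
  algebra with the defining relations by its unique maximal ideal meeting H trivially.)\<close>

definition contragredient_superalgebra ::
  "('i::finite \<Rightarrow> 'i \<Rightarrow> complex) \<Rightarrow> ('i \<Rightarrow> bool) \<Rightarrow>
   (complex \<Rightarrow> 'v::ab_group_add \<Rightarrow> 'v) \<Rightarrow> ('v \<Rightarrow> 'v \<Rightarrow> 'v) \<Rightarrow> 'v set \<Rightarrow> 'v set \<Rightarrow>
   'v set \<Rightarrow> ('i \<Rightarrow> 'v \<Rightarrow> complex) \<Rightarrow> ('i \<Rightarrow> 'v) \<Rightarrow> ('i \<Rightarrow> 'v) \<Rightarrow> ('i \<Rightarrow> 'v) \<Rightarrow> bool" where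
  "contragredient_superalgebra A p sc br V0 V1 H alpha hh X Y \<longleftrightarrow>
     lie_superalgebra sc br V0 V1 \<and>
     module.subspace sc H \<and> H \<subseteq> V0 \<and>
     (\<exists>B. finite B \<and> B \<subseteq> H \<and> \<not> module.dependent sc B \<and> module.span sc B = H \<and>
          card B = card (UNIV :: 'i set) + mat_corank A) \<and>
     (\<forall>i. \<forall>x\<in>H. \<forall>y\<in>H. \<forall>c. alpha i (sc c x + y) = c * alpha i x + alpha i y) \<and>
     (\<forall>c :: 'i \<Rightarrow> complex. (\<forall>h\<in>H. (\<Sum>i\<in>UNIV. c i * alpha i h) = 0) \<longrightarrow> (\<forall>i. c i = 0)) \<and>
     (\<forall>i. hh i \<in> H) \<and> (\<forall>i j. alpha j (hh i) = A i j) \<and>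
     (\<forall>i. X i \<in> par_part V0 V1 (p i) \<and> Y i \<in> par_part V0 V1 (p i)) \<and>
     (\<forall>h\<in>H. \<forall>h'\<in>H. br h h' = 0) \<and>
     (\<forall>h\<in>H. \<forall>i. br h (X i) = sc (alpha i h) (X i)) \<and>
     (\<forall>h\<in>H. \<forall>i. br h (Y i) = sc (- alpha i h) (Y i)) \<and>
     (\<forall>i j. br (X i) (Y j) = (if i = j then hh i else 0)) \<and>
     (\<forall>S. module.subspace sc S \<and> H \<subseteq> S \<and> range X \<subseteq> S \<and> range Y \<subseteq> S \<and>
          (\<forall>x\<in>S. \<forall>y\<in>S. br x y \<in> S) \<longrightarrow> S = UNIV) \<and>
     (\<forall>J. lie_ideal sc br J \<and> J \<inter> H = {0} \<longrightarrow> J = {0})"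

inductive has_pdeg ::
  "('v \<Rightarrow> 'v \<Rightarrow> 'v) \<Rightarrow> 'v set \<Rightarrow> ('i \<Rightarrow> 'v) \<Rightarrow> ('i \<Rightarrow> 'v) \<Rightarrow> 'v \<Rightarrow> int \<Rightarrow> bool"
  for br H X Y where
  cartan: "h \<in> H \<Longrightarrow> has_pdeg br H X Y h 0"
| posgen: "has_pdeg br H X Y (X i) 1"
| neggen: "has_pdeg br H X Y (Y i) (-1)"
| bracket: "has_pdeg br H X Y u a \<Longrightarrow> has_pdeg br H X Y w b \<Longrightarrow>
            has_pdeg br H X Y (br u w) (a + b)"

definition graded_piece ::
  "(complex \<Rightarrow> 'v::ab_group_add \<Rightarrow> 'v) \<Rightarrow> ('v \<Rightarrow> 'v \<Rightarrow> 'v) \<Rightarrow> 'v set \<Rightarrow> ('i \<Rightarrow> 'v) \<Rightarrow> ('i \<Rightarrow> 'v)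
   \<Rightarrow> int \<Rightarrow> 'v set" where
  "graded_piece sc br H X Y m = module.span sc {u. has_pdeg br H X Y u m}"

definition finite_growth ::
  "(complex \<Rightarrow> 'v::ab_group_add \<Rightarrow> 'v) \<Rightarrow> ('v \<Rightarrow> 'v \<Rightarrow> 'v) \<Rightarrow> 'v set \<Rightarrow> ('i \<Rightarrow> 'v) \<Rightarrow> ('i \<Rightarrow> 'v) \<Rightarrow> bool" where
  "finite_growth sc br H X Y \<longleftrightarrow>
     (\<exists>C::nat. \<exists>d::nat. \<forall>m::int. \<exists>B. finite B \<and> module.span sc B = graded_piece sc br H X Y m \<and>
        card B \<le> C * (1 + nat \<bar>m\<bar>) ^ d)"

end

theory Submission
  imports Defs
begin

text \<open>
  Let \<open>E, F\<close> be an even \<open>sl\<^sub>2\<close>- or Heisenberg pair attached to an index \<open>i\<close> (the squares of \<open>X\<^sub>i, Y\<^sub>i\<close> if \<open>i\<close> is odd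
  and non-isotropic), and put \<open>x\<^sub>n = (ad E)^n X\<^sub>j\<close>, \<open>y\<^sub>n = (ad F)^n Y\<^sub>j\<close>. Then \<open>[x\<^sub>m, y\<^sub>n] = 0\<close> for \<open>m + 2 \<le> n\<close> and
  \<open>[x\<^sub>n, y\<^sub>n]\<close> is an explicit multiple of \<open>a\<^sub>i\<^sub>j h\<^sub>j + n a\<^sub>j\<^sub>i h\<^sub>i\<close>. If one of the conditions fails for \<open>i, j\<close>, the \<open>x\<^sub>n\<close> do not
  vanish, and the brackets \<open>[x\<^sub>n\<^sub>k, [\<dots>, [x\<^sub>n\<^sub>1, u]]]\<close> over increasing sequences of multiples of 3 are linearly
  independent, since \<open>ad y\<^sub>n\<close> with \<open>n\<close> the largest index strips off the outermost letter. This gives \<open>2^N\<close> independent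
  elements of degree \<open>O(N\<^sup>2)\<close>, contradicting polynomial growth.

  A reflected matrix is realised inside the same vector space: \<open>X\<^sub>k, Y\<^sub>k\<close> are swapped and each neighbour \<open>X\<^sub>i\<close> is replaced
  by \<open>[X\<^sub>k, X\<^sub>i]\<close>. The relations for this need \<open>[X\<^sub>k, X\<^sub>k] = 0\<close> and \<open>[X\<^sub>k, X\<^sub>i] = 0\<close> for non-neighbours. After a singular
  reflection the new generators generate only a subalgebra, where these may fail; so one first passes to the quotient
  of that subalgebra by the ideal they generate. The ideal has no weight-zero part, hence meets no \<open>h\<^sub>i\<close>, and neither
  passing to subquotients nor changing generators destroys polynomial growth.
\<close>

section \<open>Lie superalgebras\<close>

locale lie_super =
  fixes sc :: "complex \<Rightarrow> 'v::ab_group_add \<Rightarrow> 'v" and br :: "'v \<Rightarrow> 'v \<Rightarrow> 'v" and V0 V1 :: "'v set"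
  assumes lie_superalgebra: "lie_superalgebra sc br V0 V1"

sublocale lie_super \<subseteq> vector_space sc
  using lie_superalgebra by (simp add: lie_superalgebra_def)

context lie_super
begin

abbreviation par :: "bool \<Rightarrow> 'v set" where "par \<equiv> par_part V0 V1"

lemma subspace_par: "subspace (par b)"
  using lie_superalgebra by (cases b) (simp_all add: lie_superalgebra_def par_part_def)

lemma par_decomp:
  obtains a b where "a \<in> par False" "b \<in> par True" "v = a + b"
proof -
  have "\<forall>v. \<exists>a\<in>V0. \<exists>b\<in>V1. v = a + b"
    using lie_superalgebra unfolding lie_superalgebra_def by (elim conjE)
  then show ?thesis using that by (auto simp: par_part_def)
qed

lemma par_disjoint: "x \<in> par False \<Longrightarrow> x \<in> par True \<Longrightarrow> x = 0"
proof -
  have "V0 \<inter> V1 = {0}"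
    using lie_superalgebra unfolding lie_superalgebra_def by (elim conjE)
  then show "x \<in> par False \<Longrightarrow> x \<in> par True \<Longrightarrow> x = 0" by (auto simp: par_part_def)
qed

lemma br_add_left: "br (x + y) z = br x z + br y z"
  and br_add_right: "br x (y + z) = br x y + br x z"
  and br_scale_left: "br (sc c x) y = sc c (br x y)"
  and br_scale_right: "br x (sc c y) = sc c (br x y)"
  using lie_superalgebra by (simp_all add: lie_superalgebra_def)

lemma par_br: "x \<in> par a \<Longrightarrow> y \<in> par b \<Longrightarrow> br x y \<in> par (a \<noteq> b)"
  and skew: "x \<in> par a \<Longrightarrow> y \<in> par b \<Longrightarrow> br x y = - sc (super_sign a b) (br y x)"
  and jacobi: "x \<in> par a \<Longrightarrow> y \<in> par b \<Longrightarrow>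
    br x (br y z) = br (br x y) z + sc (super_sign a b) (br y (br x z))"
  using lie_superalgebra unfolding lie_superalgebra_def by blast+

lemma linear_br: "Vector_Spaces.linear sc sc (br x)"
  by unfold_locales (simp_all add: br_add_right br_scale_right)

lemma br_0_right [simp]: "br x 0 = 0"
  using br_scale_right[of x 0 0] by simp

lemma br_0_left [simp]: "br 0 x = 0"
  using br_scale_left[of 0 0 x] by simp

lemma br_minus_right: "br x (- y) = - br x y"
  using br_scale_right[of x "-1" y] by simp

lemma br_minus_left: "br (- x) y = - br x y"
  using br_scale_left[of "-1" x y] by simp

lemma br_diff_right: "br x (y - z) = br x y - br x z"
  using br_add_right[of x y "- z"] by (simp add: br_minus_right)

lemma br_diff_left: "br (x - y) z = br x z - br y z"
  using br_add_left[of x "- y" z] by (simp add: br_minus_left)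

lemmas br_simps = br_add_left br_add_right br_scale_left br_scale_right
  br_minus_left br_minus_right br_diff_left br_diff_right

lemma jacobi_left: "x \<in> par a \<Longrightarrow> y \<in> par b \<Longrightarrow>
    br (br x y) z = br x (br y z) - sc (super_sign a b) (br y (br x z))"
  using jacobi[of x a y b z] by simp

lemma skew_even: "x \<in> par False \<Longrightarrow> br x y = - br y x"
proof (rule par_decomp[of y])
  fix a b assume "x \<in> par False" "a \<in> par False" "b \<in> par True" "y = a + b"
  then show ?thesis
    using skew[of x False a False] skew[of x False b True]
    by (simp add: br_add_left br_add_right super_sign_def)
qed

lemma jacobi_even: "x \<in> par False \<Longrightarrow> br x (br y z) = br (br x y) z + br y (br x z)"
proof (rule par_decomp[of y])
  fix a b assume "x \<in> par False" "a \<in> par False" "b \<in> par True" "y = a + b"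
  then show ?thesis
    using jacobi[of x False a False z] jacobi[of x False b True z]
    by (simp add: br_simps super_sign_def)
qed

lemma self_0: "(x::'v) = - x \<Longrightarrow> x = 0"
proof -
  assume "x = - x"
  then have "x + x = 0" by (metis add.left_inverse)
  then have "sc (1 + 1) x = 0" unfolding scale_left_distrib by simp
  then show ?thesis by simp
qed

lemma br_self_even: "x \<in> par False \<Longrightarrow> br x x = 0"
  using skew_even[of x x] self_0 by blast

end

text \<open>Applying \<open>f\<close> to a vanishing combination erases the \<open>W\<close> part
  and turns the other part back into a combination of \<open>W\<close>, so those coefficients vanish
  first. This is the doubling step for the word families, with \<open>e = ad x\<^sub>n\<close> and
  \<open>f = ad y\<^sub>n\<close>.\<close>

lemma (in vector_space) independent_Un_image:
  assumes "Vector_Spaces.linear scale scale e" and "Vector_Spaces.linear scale scale f"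
    and fin: "finite W" and ind: "independent W"
    and f0: "\<And>v. v \<in> W \<Longrightarrow> f v = 0"
    and fe: "\<And>v. v \<in> W \<Longrightarrow> f (e v) = scale (\<mu> v) v"
    and \<mu>: "\<And>v. v \<in> W \<Longrightarrow> \<mu> v \<noteq> 0"
  shows "independent (W \<union> e ` W)" and "card (W \<union> e ` W) = 2 * card W"
proof -
  interpret e: Vector_Spaces.linear scale scale e by fact
  interpret f: Vector_Spaces.linear scale scale f by fact
  have inj: "inj_on e W"
  proof (rule inj_onI, rule ccontr)
    fix v w assume vw: "v \<in> W" "w \<in> W" "e v = e w" "v \<noteq> w"
    then have eq: "scale (\<mu> v) v = scale (\<mu> w) w" using fe by metis
    have "v = scale (inverse (\<mu> v)) (scale (\<mu> v) v)" using \<mu> vw by simp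
    then have "v = scale (inverse (\<mu> v) * \<mu> w) w" using eq by simp
    then have "v \<in> span (W - {v})"
      using vw by (metis Diff_iff empty_iff insert_iff span_base span_scale)
    with ind vw(1) show False by (auto simp: dependent_def)
  qed
  have disj: "W \<inter> e ` W = {}"
  proof (rule ccontr)
    assume "W \<inter> e ` W \<noteq> {}"
    then obtain v where "v \<in> W" "e v \<in> W" by auto
    then have "v = 0" using fe[of v] f0[of "e v"] \<mu> by simp
    with \<open>v \<in> W\<close> ind dependent_zero show False by blast
  qed
  show "card (W \<union> e ` W) = 2 * card W"
    using inj disj fin by (simp add: card_Un_disjoint card_image)
  show "independent (W \<union> e ` W)"
  proof (rule independent_if_scalars_zero)
    fix \<phi> z assume z: "z \<in> W \<union> e ` W" and "(\<Sum>x\<in>W \<union> e ` W. scale (\<phi> x) x) = 0"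
    then have sum: "(\<Sum>v\<in>W. scale (\<phi> v) v) + (\<Sum>v\<in>W. scale (\<phi> (e v)) (e v)) = 0"
      using fin disj inj by (simp add: sum.union_disjoint sum.reindex)
    have "f ((\<Sum>v\<in>W. scale (\<phi> v) v) + (\<Sum>v\<in>W. scale (\<phi> (e v)) (e v)))
        = (\<Sum>v\<in>W. scale (\<phi> (e v) * \<mu> v) v)"
      by (simp add: f.add f.sum f.scale f0 fe)
    with sum have "(\<Sum>v\<in>W. scale (\<phi> (e v) * \<mu> v) v) = 0" by (simp add: f.zero)
    then have *: "\<phi> (e v) * \<mu> v = 0" if "v \<in> W" for v
      using independentD[OF ind fin subset_refl _ that, of "\<lambda>v. \<phi> (e v) * \<mu> v"] by blast
    then have e0: "\<phi> (e v) = 0" if "v \<in> W" for v using \<mu> that by simp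
    then have "(\<Sum>v\<in>W. scale (\<phi> v) v) = 0" using sum by simp
    then have "\<phi> v = 0" if "v \<in> W" for v
      using independentD[OF ind fin subset_refl _ that] by simp
    with e0 z show "\<phi> z = 0" by auto
  qed (use fin in simp)
qed

section \<open>Growth measured by word length\<close>

inductive bracket_word :: "('v \<Rightarrow> 'v \<Rightarrow> 'v) \<Rightarrow> ('i \<Rightarrow> 'v) \<Rightarrow> ('i \<Rightarrow> 'v) \<Rightarrow> 'v \<Rightarrow> nat \<Rightarrow> bool"
  for br X Y where
  X: "bracket_word br X Y (X i) 1"
| Y: "bracket_word br X Y (Y i) 1"
| br: "bracket_word br X Y u m \<Longrightarrow> bracket_word br X Y w n \<Longrightarrow> bracket_word br X Y (br u w) (m + n)"

text \<open>Words of length at most \<open>L\<close> are bounded instead of graded pieces. This form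
  refers neither to a grading nor to the Cartan subalgebra, so it passes to subquotients and to
  generators that are short words in the old ones.\<close>

definition poly_growth ::
  "(complex \<Rightarrow> 'v::ab_group_add \<Rightarrow> 'v) \<Rightarrow> ('v \<Rightarrow> 'v \<Rightarrow> 'v) \<Rightarrow> ('i \<Rightarrow> 'v) \<Rightarrow> ('i \<Rightarrow> 'v) \<Rightarrow> bool" where
  "poly_growth sc br X Y \<longleftrightarrow>
     (\<exists>C::nat. \<exists>d::nat. \<forall>L::nat. \<exists>B. finite B \<and> card B \<le> C * (1 + L) ^ d \<and>
        (\<forall>u n. bracket_word br X Y u n \<and> n \<le> L \<longrightarrow> u \<in> module.span sc B))"

text \<open>For an even index \<open>i\<close>, the pair \<open>E, F\<close> is \<open>X\<^sub>i, Y\<^sub>i\<close>, while \<open>x, y\<close> is \<open>X\<^sub>j, Y\<^sub>j\<close>; then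
  \<open>a, b, b', d\<close> are \<open>a\<^sub>i\<^sub>i, a\<^sub>i\<^sub>j, a\<^sub>j\<^sub>i, a\<^sub>j\<^sub>j\<close>.\<close>

locale lowest_string = lie_super sc br V0 V1
  for sc :: "complex \<Rightarrow> 'v::ab_group_add \<Rightarrow> 'v" and br :: "'v \<Rightarrow> 'v \<Rightarrow> 'v" and V0 V1 :: "'v set" +
  fixes E F x y h g :: 'v and a b b' d :: complex and q :: bool
  assumes E: "E \<in> par False" and F: "F \<in> par False" and x: "x \<in> par q" and y: "y \<in> par q"
    and EF: "br E F = h" and xy: "br x y = g" and Ey: "br E y = 0" and Fx: "br F x = 0"
    and hE: "br h E = sc a E" and hF: "br h F = sc (- a) F" and hx: "br h x = sc b x"
    and gE: "br g E = sc b' E" and gF: "br g F = sc (- b') F" and gx: "br g x = sc d x"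
begin

definition xs :: "nat \<Rightarrow> 'v" where "xs n = (br E ^^ n) x"
definition ys :: "nat \<Rightarrow> 'v" where "ys n = (br F ^^ n) y"
text \<open>Minus the sum of the \<open>h\<close>-weights \<open>b + k a\<close> of
  \<open>xs k\<close> over \<open>k < n\<close>. Each commutation of \<open>F\<close> past
  \<open>E\<close> subtracts one such weight, so by \<open>F_xs\<close> this is the scalar with
  which \<open>ad F\<close> lowers \<open>xs n\<close> to \<open>xs (n - 1)\<close>.\<close>

definition c :: "nat \<Rightarrow> complex" where "c n = - (of_nat n * b + of_nat n * (of_nat n - 1) / 2 * a)"

lemma xs_simps [simp]: "xs 0 = x" "br E (xs n) = xs (Suc n)"
  and ys_simps [simp]: "ys 0 = y" "br F (ys n) = ys (Suc n)"
  by (simp_all add: xs_def ys_def)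

lemma h_even: "h \<in> par False" and g_even: "g \<in> par False"
  using par_br[OF E F] par_br[OF x y] EF xy by auto

lemma xs_par: "xs n \<in> par q"
proof (induction n)
  case (Suc n) then show ?case using par_br[OF E Suc] by simp
qed (simp add: x)

lemma ys_par: "ys n \<in> par q"
proof (induction n)
  case (Suc n) then show ?case using par_br[OF F Suc] by simp
qed (simp add: y)

lemma h_xs: "br h (xs n) = sc (b + of_nat n * a) (xs n)"
proof (induction n)
  case (Suc n)
  have "br h (br E (xs n)) = br (br h E) (xs n) + br E (br h (xs n))"
    by (rule jacobi_even[OF h_even])
  then show ?case using Suc by (simp add: hE br_simps scale_left_distrib algebra_simps)
qed (simp add: hx)

lemma g_xs: "br g (xs n) = sc (d + of_nat n * b') (xs n)"
proof (induction n)
  case (Suc n)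
  have "br g (br E (xs n)) = br (br g E) (xs n) + br E (br g (xs n))"
    by (rule jacobi_even[OF g_even])
  then show ?case using Suc by (simp add: gE br_simps scale_left_distrib algebra_simps)
qed (simp add: gx)

lemma F_xs: "br F (xs (Suc n)) = sc (c (Suc n)) (xs n)"
proof (induction n)
  case 0
  have "br E (br F x) = br h x + br F (br E x)"
    using jacobi_even[OF E] EF by metis
  then have "br F (br E x) = - sc b x" by (simp add: Fx hx eq_neg_iff_add_eq_0 add.commute)
  then show ?case using xs_simps(2)[of 0] by (simp add: c_def)
next
  case (Suc n)
  have "br E (br F (xs (Suc n))) = br h (xs (Suc n)) + br F (br E (xs (Suc n)))"
    using jacobi_even[OF E] EF by metis
  then have "br F (xs (Suc (Suc n))) = sc (c (Suc n)) (xs (Suc n)) - sc (b + of_nat (Suc n) * a) (xs (Suc n))"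
    using Suc h_xs[of "Suc n"] by (simp add: br_simps)
  also have "\<dots> = sc (c (Suc (Suc n))) (xs (Suc n))"
    unfolding scale_left_diff_distrib[symmetric]
    by (rule arg_cong[where f = "\<lambda>t. sc t _"]) (simp add: c_def field_simps)
  finally show ?case .
qed

text \<open>Since \<open>E\<close> commutes with \<open>y\<close>, the bracket is
  \<open>(ad E)^n g\<close>; one application gives a multiple of \<open>E\<close>, which the even
  element \<open>E\<close> annihilates.\<close>

lemma xs_y: "br (xs (Suc 0)) y = - sc b' E" "br (xs (Suc (Suc n))) y = 0"
proof -
  have step: "br (xs (Suc n)) y = br E (br (xs n) y)" for n
    using jacobi_even[OF E, of "xs n" y] by (simp add: Ey)
  show 1: "br (xs (Suc 0)) y = - sc b' E"
    using step[of 0] skew_even[OF E, of g] by (simp add: xy gE)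
  show "br (xs (Suc (Suc n))) y = 0"
  proof (induction n)
    case 0 then show ?case using step[of "Suc 0"] 1 br_self_even[OF E] by (simp add: br_simps)
  next
    case (Suc n) then show ?case using step[of "Suc (Suc n)"] by simp
  qed
qed

lemma xs_ys_Suc: "br (xs n) (ys (Suc m)) = br F (br (xs n) (ys m)) - br (br F (xs n)) (ys m)"
  using jacobi_even[OF F, of "xs n" "ys m"] by simp

lemma c_1: "c (Suc 0) = - b"
  by (simp add: c_def)

lemma F_E: "br F E = - h" and F_h: "br F h = sc a F" and F_g: "br F g = sc b' F"
  using skew_even[OF F, of E] skew_even[OF F, of h] skew_even[OF F, of g] hF gF EF by auto

text \<open>The Leibniz rule \<open>xs_ys_Suc\<close> expresses each bracket through two with a
  smaller index on \<open>ys\<close>, so the diagonal and all off-diagonals go through one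
  induction. Each step multiplies \<open>s\<close> by \<open>- c (m + 2)\<close>. The factor
  \<open>c 1 = - b\<close> is absorbed into the coefficient of \<open>g\<close>, which is why
  \<open>c n\<close> is constrained only from \<open>n = 2\<close> on and \<open>b = 0\<close> stays
  admissible.\<close>

lemma xs_ys:
  assumes c: "\<And>n. n \<ge> 2 \<Longrightarrow> c n \<noteq> 0"
  shows "\<exists>s. s \<noteq> 0 \<and> br (xs (Suc m)) (ys (Suc m)) = sc s (sc b g + sc (of_nat (Suc m) * b') h) \<and>
     br (xs (Suc (Suc m))) (ys (Suc m)) = sc (s * c (Suc (Suc m)) * b') E \<and>
     (\<forall>n\<ge>Suc (Suc (Suc m)). br (xs n) (ys (Suc m)) = 0) \<and>
     (\<exists>\<phi>. br (xs m) (ys (Suc m)) = sc \<phi> F) \<and> (\<forall>n<m. br (xs n) (ys (Suc m)) = 0)"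
proof (induction m)
  case 0
  have "br (xs n) (ys (Suc 0)) = 0" if n: "n \<ge> Suc (Suc (Suc 0))" for n
  proof -
    obtain k where "n = Suc (Suc (Suc k))" using n by (metis Suc_le_D Suc_le_mono)
    then show ?thesis using xs_ys_Suc[of n 0] F_xs[of "Suc (Suc k)"] xs_y(2) by (simp add: br_simps)
  qed
  moreover have "br (xs (Suc 0)) (ys (Suc 0)) = sc 1 (sc b g + sc (of_nat (Suc 0) * b') h)"
    using xs_ys_Suc[of "Suc 0" 0] F_xs[of 0] by (simp add: xs_y c_1 xy br_simps F_E)
  moreover have "br (xs (Suc (Suc 0))) (ys (Suc 0)) = sc (1 * c (Suc (Suc 0)) * b') E"
    using xs_ys_Suc[of "Suc (Suc 0)" 0] F_xs[of "Suc 0"] by (simp add: xs_y br_simps)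
  moreover have "br (xs 0) (ys (Suc 0)) = sc b' F"
    using xs_ys_Suc[of 0 0] by (simp add: xy Fx F_g)
  ultimately show ?case by (intro exI[of _ 1]) auto
next
  case (Suc m)
  then obtain s \<phi> where s: "s \<noteq> 0"
    and eq: "br (xs (Suc m)) (ys (Suc m)) = sc s (sc b g + sc (of_nat (Suc m) * b') h)"
    and up: "br (xs (Suc (Suc m))) (ys (Suc m)) = sc (s * c (Suc (Suc m)) * b') E"
    and upup: "\<And>n. n\<ge>Suc (Suc (Suc m)) \<Longrightarrow> br (xs n) (ys (Suc m)) = 0"
    and dn: "br (xs m) (ys (Suc m)) = sc \<phi> F" and dndn: "\<And>n. n<m \<Longrightarrow> br (xs n) (ys (Suc m)) = 0"
    by blast
  define s' where "s' = - s * c (Suc (Suc m))"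
  have "s' \<noteq> 0" using s c[of "Suc (Suc m)"] by (simp add: s'_def)
  moreover have "br (xs (Suc (Suc m))) (ys (Suc (Suc m))) = sc s' (sc b g + sc (of_nat (Suc (Suc m)) * b') h)"
    unfolding xs_ys_Suc[of "Suc (Suc m)" "Suc m"] F_xs br_simps eq up F_E s'_def
    by (simp add: scale_right_distrib scale_left_distrib scale_left_diff_distrib algebra_simps)
      (simp flip: scale_left_distrib)
  moreover have "br (xs (Suc (Suc (Suc m)))) (ys (Suc (Suc m))) = sc (s' * c (Suc (Suc (Suc m))) * b') E"
    using xs_ys_Suc[of "Suc (Suc (Suc m))" "Suc m"] F_xs[of "Suc (Suc m)"] up upup
    by (simp add: br_simps s'_def mult_ac)
  moreover have "br (xs n) (ys (Suc (Suc m))) = 0" if n: "n \<ge> Suc (Suc (Suc (Suc m)))" for n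
  proof -
    obtain k where "n = Suc k" "k \<ge> Suc (Suc (Suc m))" using n by (metis Suc_le_D Suc_le_mono)
    then show ?thesis using xs_ys_Suc[of n "Suc m"] F_xs[of k] upup by (simp add: br_simps)
  qed
  moreover have "\<exists>\<phi>. br (xs (Suc m)) (ys (Suc (Suc m))) = sc \<phi> F"
    using xs_ys_Suc[of "Suc m" "Suc m"] F_xs[of m] eq dn
    by (auto simp: br_simps F_h F_g simp flip: scale_left_distrib scale_left_diff_distrib)
  moreover have "br (xs n) (ys (Suc (Suc m))) = 0" if n: "n < Suc m" for n
  proof (cases n)
    case 0
    then show ?thesis using xs_ys_Suc[of 0 "Suc m"] dn dndn[of 0] n br_self_even[OF F]
      by (cases m) (auto simp: Fx br_simps)
  next
    case (Suc k)
    then have "br (xs k) (ys (Suc m)) = 0" using dndn n by simp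
    moreover have "br F (br (xs n) (ys (Suc m))) = 0"
      using dn dndn[of n] n br_self_even[OF F] by (cases "n = m") (auto simp: br_simps)
    ultimately show ?thesis using xs_ys_Suc[of n "Suc m"] F_xs[of k] Suc by (simp add: br_simps)
  qed
  ultimately show ?case by blast
qed

end

section \<open>Exponentially many independent bracket words\<close>

lemma square_le_two_power: "n \<ge> 4 \<Longrightarrow> n ^ 2 \<le> (2::nat) ^ n"
proof (induction n rule: dec_induct)
  case (step n)
  have "4 * n \<le> n * n" using step(1) by simp
  then have "2 * n + 1 \<le> n * n" using step(1) by linarith
  then have "Suc n ^ 2 \<le> 2 * n ^ 2" by (simp add: power2_eq_square)
  then show ?case using step.IH by simp
qed simp

text \<open>Taking \<open>N = 2^t\<close> bounds the polynomial by
  \<open>C' * 2^(2 * d * t)\<close>, whose exponent grows only linearly in \<open>t\<close>. The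
  quadratic in \<open>N\<close> is the word length from \<open>family_bracket_word\<close>.\<close>

lemma exp_beats_poly: "\<exists>N\<ge>N0. C * (1 + (L0 + N * (12 * N + 1))) ^ d < (2::nat) ^ N"
proof -
  define C' where "C' = C * (14 + L0) ^ d"
  define t where "t = N0 + C' + 2 * d + 4"
  define N :: nat where "N = 2 ^ t"
  have N: "N \<ge> t" "N \<ge> 1" unfolding N_def by (simp_all add: less_imp_le)
  have "C' + 2 * d * t \<le> (C' + 2 * d) * t" by (simp add: t_def algebra_simps)
  also have "\<dots> \<le> t * t" by (intro mult_right_mono) (simp_all add: t_def)
  also have "\<dots> \<le> N"
    using square_le_two_power[of t] by (simp add: t_def N_def power2_eq_square)
  finally have t: "C' + 2 * d * t \<le> N" .
  have "L0 \<le> L0 * (N * N)" "1 \<le> N * N" "N \<le> N * N" using N(2) by simp_all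
  then have "1 + (L0 + (12 * (N * N) + N)) \<le> 14 * (N * N) + L0 * (N * N)" by linarith
  then have "1 + (L0 + N * (12 * N + 1)) \<le> (14 + L0) * N ^ 2"
    by (simp only: power2_eq_square ring_distribs mult_1_right mult.left_commute)
  then have "C * (1 + (L0 + N * (12 * N + 1))) ^ d \<le> C * ((14 + L0) * N ^ 2) ^ d"
    by (intro mult_left_mono power_mono) simp_all
  also have "\<dots> = C' * 2 ^ (2 * d * t)"
    by (simp add: C'_def N_def power_mult_distrib mult_ac flip: power_mult)
  also have "\<dots> < 2 ^ C' * 2 ^ (2 * d * t)"
    by (intro mult_strict_right_mono) simp_all
  also have "\<dots> \<le> 2 ^ N"
    unfolding power_add[symmetric] using t by (intro power_increasing) simp_all
  finally show ?thesis using N(1) t_def by (intro exI[of _ N]) auto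
qed

text \<open>In \<open>weight_nonzero\<close>, \<open>K\<close> and \<open>M\<close> are the number and the sum of the indices of the letters already
  applied to \<open>u\<close>; the left-hand side is the eigenvalue of \<open>b g + n b' h\<close> on the resulting word.\<close>

locale string_words = lowest_string sc br V0 V1 E F x y h g a b b' d q
  for sc :: "complex \<Rightarrow> 'v::ab_group_add \<Rightarrow> 'v" and br V0 V1 E F x y h g a b b' d q +
  fixes u :: 'v and l l' :: complex and N0 :: nat
  assumes c_nonzero: "n \<ge> 2 \<Longrightarrow> c n \<noteq> 0"
    and u_nonzero: "u \<noteq> 0" and hu: "br h u = sc l u" and gu: "br g u = sc l' u"
    and N0: "N0 \<ge> 1" and ys_u: "n \<ge> N0 \<Longrightarrow> br (ys n) u = 0"
    and weight_nonzero: "N \<ge> N0 \<Longrightarrow> n \<ge> N \<Longrightarrow> N * K \<le> M \<Longrightarrow> K = 0 \<longrightarrow> M = 0 \<Longrightarrow>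
      b * (l' + of_nat K * d + of_nat M * b') + of_nat n * b' * (l + of_nat K * b + of_nat M * a) \<noteq> 0"
begin

text \<open>The bracket of \<open>xs n\<close> and \<open>ys k\<close> vanishes for
  \<open>k \<ge> n + 2\<close>, so \<open>ad (ys k)\<close> passes through \<open>ad (xs n)\<close>
  up to sign.\<close>

lemma ys_xs_far:
  assumes "n + 2 \<le> k" and "br (ys k) v = 0"
  shows "br (ys k) (br (xs n) v) = 0"
proof -
  obtain m where m: "k = Suc m" "n < m" using assms(1) by (cases k) auto
  have "br (xs n) (ys k) = 0" using xs_ys[OF c_nonzero, of m] m by blast
  then have "br (ys k) (xs n) = 0" using skew[OF ys_par xs_par, of k n] by simp
  then show ?thesis using jacobi[OF ys_par xs_par, of k n v] assms(2) by simp
qed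

text \<open>As \<open>ys n\<close> kills \<open>v\<close>, only
  \<open>[[y\<^sub>n, x\<^sub>n], v]\<close> survives. By \<open>xs_ys\<close> the inner commutator
  is a nonzero scalar times \<open>b g + n b' h\<close>, which acts on the weight vector
  \<open>v\<close> by the number in \<open>nz\<close>.\<close>

lemma ys_xs_same:
  assumes "n \<ge> 1" and "br (ys n) v = 0" and "br h v = sc \<kappa> v" and "br g v = sc \<kappa>' v"
    and nz: "b * \<kappa>' + of_nat n * b' * \<kappa> \<noteq> 0"
  shows "\<exists>\<mu>. \<mu> \<noteq> 0 \<and> br (ys n) (br (xs n) v) = sc \<mu> v"
proof -
  obtain m where m: "n = Suc m" using assms(1) by (cases n) auto
  obtain s where s: "s \<noteq> 0" "br (xs n) (ys n) = sc s (sc b g + sc (of_nat n * b') h)"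
    using xs_ys[OF c_nonzero, of m] m by blast
  have sgn: "super_sign q q \<noteq> 0" by (simp add: super_sign_def)
  have "br (ys n) (br (xs n) v) = br (br (ys n) (xs n)) v"
    using jacobi[OF ys_par xs_par, of n n v] assms(2) by simp
  also have "\<dots> = sc (- (super_sign q q * s * (b * \<kappa>' + of_nat n * b' * \<kappa>))) v"
    unfolding skew[OF ys_par xs_par, of n n] s(2) br_simps assms(3,4)
    by (simp only: scale_scale mult.assoc scale_minus_left flip: scale_left_distrib)
  finally show ?thesis
    using s(1) sgn nz
    by (intro exI[of _ "- (super_sign q q * s * (b * \<kappa>' + of_nat n * b' * \<kappa>))"] conjI)
      (simp_all only: neg_equal_0_iff_equal mult_eq_0_iff not_False_eq_True simp_thms)
qed

text \<open>Every letter is either applied or skipped, giving one word per subset of the indices.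
  Spacing 3 keeps distinct letters at least 2 apart, as \<open>ys_xs_far\<close> requires; starting
  at \<open>3 * N\<close> makes the index sum \<open>M\<close> of a word at least \<open>N\<close>
  times its number \<open>K\<close> of letters.\<close>

fun family :: "nat \<Rightarrow> nat \<Rightarrow> 'v set" where
  "family N 0 = {u}"
| "family N (Suc m) = family N m \<union> br (xs (3 * (N + m))) ` family N m"

lemma finite_family: "finite (family N m)"
  by (induction m) auto

lemma family_weight:
  assumes "N \<ge> N0" and "v \<in> family N m"
  shows "\<exists>K M. N * K \<le> M \<and> (K = 0 \<longrightarrow> M = 0) \<and> br h v = sc (l + of_nat K * b + of_nat M * a) v \<and>
    br g v = sc (l' + of_nat K * d + of_nat M * b') v"
  using assms(2)
proof (induction m arbitrary: v)
  case 0
  then show ?case using hu gu by (intro exI[of _ 0]) simp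
next
  case (Suc m)
  show ?case
  proof (cases "v \<in> family N m")
    case False
    let ?n = "3 * (N + m)"
    obtain w where w: "w \<in> family N m" "v = br (xs ?n) w" using Suc.prems False by auto
    obtain K M where KM: "N * K \<le> M" "K = 0 \<longrightarrow> M = 0"
      and hw: "br h w = sc (l + of_nat K * b + of_nat M * a) w"
      and gw: "br g w = sc (l' + of_nat K * d + of_nat M * b') w"
      using Suc.IH[OF w(1)] by blast
    have "br h v = sc (l + of_nat (Suc K) * b + of_nat (M + ?n) * a) v"
      unfolding w(2) jacobi_even[OF h_even] h_xs br_simps hw
      by (simp flip: scale_left_distrib) (simp add: algebra_simps)
    moreover have "br g v = sc (l' + of_nat (Suc K) * d + of_nat (M + ?n) * b') v"
      unfolding w(2) jacobi_even[OF g_even] g_xs br_simps gw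
      by (simp flip: scale_left_distrib) (simp add: algebra_simps)
    moreover have "N * Suc K \<le> M + ?n" using KM by simp
    ultimately show ?thesis by blast
  qed (use Suc in blast)
qed

lemma ys_family:
  assumes "N \<ge> N0" and "v \<in> family N m" and "k \<ge> 3 * (N + m)"
  shows "br (ys k) v = 0"
  using assms(2,3)
proof (induction m arbitrary: v)
  case 0
  then show ?case using ys_u assms(1) by simp
next
  case (Suc m)
  then show ?case by (auto intro!: ys_xs_far)
qed

text \<open>For the next index \<open>n\<close>, \<open>ad (ys n)\<close> annihilates the old words
  and returns the new ones to nonzero multiples of the old ones, so
  \<open>independent_Un_image\<close> doubles the family.\<close>

lemma independent_family:
  assumes "N \<ge> N0"
  shows "independent (family N m) \<and> card (family N m) = 2 ^ m"
proof (induction m)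
  case 0
  then show ?case using u_nonzero by simp
next
  case (Suc m)
  let ?n = "3 * (N + m)"
  have "\<exists>\<mu>. \<mu> \<noteq> 0 \<and> br (ys ?n) (br (xs ?n) v) = sc \<mu> v" if v: "v \<in> family N m" for v
  proof -
    obtain K M where KM: "N * K \<le> M" "K = 0 \<longrightarrow> M = 0"
      and hw: "br h v = sc (l + of_nat K * b + of_nat M * a) v"
      and gw: "br g v = sc (l' + of_nat K * d + of_nat M * b') v"
      using family_weight[OF assms v] by blast
    show ?thesis
      by (rule ys_xs_same[OF _ ys_family[OF assms v] hw gw])
        (use N0 assms weight_nonzero[OF assms _ KM, of ?n] in auto)
  qed
  then obtain \<mu> where "\<And>v. v \<in> family N m \<Longrightarrow> \<mu> v \<noteq> 0"
    "\<And>v. v \<in> family N m \<Longrightarrow> br (ys ?n) (br (xs ?n) v) = sc (\<mu> v) v"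
    by metis
  then show ?case
    using independent_Un_image[OF linear_br linear_br finite_family, of N m "ys ?n" "xs ?n" \<mu>]
      Suc ys_family[OF assms] by simp
qed

lemma family_bracket_word:
  assumes E: "bracket_word br X Y E e" "e \<le> 2" and x: "bracket_word br X Y x 1"
    and u: "bracket_word br X Y u L0" and "v \<in> family N m" and "m \<le> N"
  shows "\<exists>k. bracket_word br X Y v k \<and> k \<le> L0 + m * (12 * N + 1)"
  using assms(5,6)
proof (induction m arbitrary: v)
  case 0
  then show ?case using u by auto
next
  case (Suc m)
  have xs: "bracket_word br X Y (xs n) (n * e + 1)" for n
  proof (induction n)
    case (Suc n) then show ?case using bracket_word.br[OF E(1) Suc] by simp
  qed (use x in simp)
  show ?case
  proof (cases "v \<in> family N m")
    case False
    let ?n = "3 * (N + m)"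
    obtain w where w: "w \<in> family N m" "v = br (xs ?n) w" using Suc.prems False by auto
    obtain k where k: "bracket_word br X Y w k" "k \<le> L0 + m * (12 * N + 1)"
      using Suc.IH[OF w(1)] Suc.prems by auto
    \<comment> \<open>The index is at most \<open>6 * N\<close> because \<open>m < N\<close>, and
      \<open>E\<close>, which may be a square, has length at most 2; so one letter has length at
      most \<open>12 * N + 1\<close>.\<close>
    have "?n \<le> 6 * N" using Suc.prems by simp
    then have "?n * e \<le> 6 * N * 2" using E(2) by (rule mult_le_mono)
    then have "?n * e + 1 + k \<le> L0 + Suc m * (12 * N + 1)" using k(2) by simp
    then show ?thesis using bracket_word.br[OF xs k(1)] w(2) by blast
  next
    case True
    then obtain k where "bracket_word br X Y v k" "k \<le> L0 + m * (12 * N + 1)"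
      using Suc.IH[of v] Suc.prems by auto
    then show ?thesis by (intro exI[of _ k]) simp
  qed
qed

text \<open>The \<open>2^N\<close> independent words of \<open>family N N\<close> have length at
  most quadratic in \<open>N\<close>, hence would lie in a span of dimension polynomial in
  \<open>N\<close>.\<close>

lemma not_poly_growth:
  assumes "bracket_word br X Y E e" "e \<le> 2" and "bracket_word br X Y x 1"
    and "bracket_word br X Y u L0"
  shows "\<not> poly_growth sc br X Y"
proof
  assume "poly_growth sc br X Y"
  then obtain C d where gr: "\<And>L. \<exists>B. finite B \<and> card B \<le> C * (1 + L) ^ d \<and>
        (\<forall>u n. bracket_word br X Y u n \<and> n \<le> L \<longrightarrow> u \<in> span B)"
    unfolding poly_growth_def by blast
  have bound: "2 ^ N \<le> C * (1 + (L0 + N * (12 * N + 1))) ^ d" if N: "N \<ge> N0" for N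
  proof -
    obtain B where B: "finite B" "card B \<le> C * (1 + (L0 + N * (12 * N + 1))) ^ d"
      "\<And>u n. bracket_word br X Y u n \<Longrightarrow> n \<le> L0 + N * (12 * N + 1) \<Longrightarrow> u \<in> span B"
      using gr by meson
    have "family N N \<subseteq> span B"
      using family_bracket_word[OF assms, of _ N N] B(3) by blast
    then have "card (family N N) \<le> card B"
      using independent_span_bound[OF B(1)] independent_family[OF N] by blast
    then show ?thesis using B(2) independent_family[OF N] by simp
  qed
  then show False using exp_beats_poly[of N0 C L0 d] by (meson not_le)
qed

end

section \<open>Finite growth forces the conditions on one matrix\<close>

text \<open>This is \<open>weight_nonzero\<close> for the start vector \<open>u = x\<close>. If
  \<open>a = 0\<close> or \<open>K = 0\<close>, a factor \<open>b\<close> cancels and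
  \<open>n |b'| > |d|\<close> decides. Otherwise \<open>n b' a M\<close> dominates:
  \<open>N (K + 1) \<le> 2 M\<close> makes the other terms smaller by a factor of order
  \<open>N\<close>. \<open>N1\<close> and \<open>N2\<close> are the two thresholds.\<close>

lemma weight_estimate:
  fixes a b b' d :: complex
  assumes "b \<noteq> 0" and "b' \<noteq> 0"
  shows "\<exists>N0\<ge>2. \<forall>N n K M::nat. N \<ge> N0 \<longrightarrow> n \<ge> N \<longrightarrow> N * K \<le> M \<longrightarrow> (K = 0 \<longrightarrow> M = 0) \<longrightarrow>
    b * (d + of_nat K * d + of_nat M * b') + of_nat n * b' * (b + of_nat K * b + of_nat M * a) \<noteq> 0"
proof -
  define P Q R where "P = norm b * norm d" and "Q = norm b * norm b'" and "R = norm b' * norm a"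
  have PQ: "P \<ge> 0" "Q > 0" using assms by (simp_all add: P_def Q_def)
  obtain N1 where N1: "norm d / norm b' < real N1" using reals_Archimedean2 by blast
  obtain N2 where N2: "(2 * P + 3 * Q) / R < real N2" using reals_Archimedean2 by blast
  define N0 where "N0 = 2 + N1 + N2"
  have "b * (d + of_nat K * d + of_nat M * b') + of_nat n * b' * (b + of_nat K * b + of_nat M * a) \<noteq> 0"
    (is "?w \<noteq> 0")
    if N: "N \<ge> N0" and n: "n \<ge> N" and M: "N * K \<le> M" and KM: "K = 0 \<longrightarrow> M = 0" for N n K M :: nat
  proof
    assume w: "?w = 0"
    have "norm d / norm b' < real n" using N1 N n by (simp add: N0_def)
    then have d: "norm d < real n * norm b'" using assms by (simp add: divide_simps)
    show False
    proof (cases "a = 0 \<or> K = 0")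
      case True
      then have "?w = b * (of_nat (K + 1) * d + of_nat (M + n * (K + 1)) * b')"
        using KM by (auto simp: algebra_simps)
      with w assms(1) have "of_nat (K + 1) * d + of_nat (M + n * (K + 1)) * b' = 0" by simp
      then have "of_nat (K + 1) * d = - (of_nat (M + n * (K + 1)) * b')"
        by (simp only: eq_neg_iff_add_eq_0)
      then have "norm (of_nat (K + 1) * d) = norm (of_nat (M + n * (K + 1)) * b')"
        by (metis norm_minus_cancel)
      then have "real (K + 1) * norm d = real (M + n * (K + 1)) * norm b'"
        by (simp only: norm_mult norm_of_nat)
      moreover have "real (n * (K + 1)) * norm b' \<le> real (M + n * (K + 1)) * norm b'"
        by (intro mult_right_mono) simp_all
      moreover have "real (K + 1) * norm d < real (K + 1) * (real n * norm b')"
        using d by (intro mult_strict_left_mono) simp_all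
      moreover have "0 \<le> real M * norm b'" by simp
      ultimately show False by (simp add: algebra_simps)
    next
      case False
      then have R: "R > 0" using assms by (simp add: R_def)
      have "(2 * P + 3 * Q) / R < real N" using N2 N by (simp add: N0_def)
      then have NR: "2 * P + 3 * Q < real N * R" using R by (simp add: divide_simps)
      have N': "N \<ge> 1" using N by (simp add: N0_def)
      have "1 * K \<le> N * K" using N' by (rule mult_right_mono) simp
      then have "K \<le> M" using M by linarith
      then have M1: "K \<le> M" "1 \<le> M" using False by auto
      have K1: "real (K + 1) \<le> 2 * real M" using M1 by simp
      have "N * (K + 1) \<le> 2 * (N * K)" using False by (cases K) auto
      then have "N * (K + 1) \<le> 2 * M" using M by linarith
      then have NK: "real N * real (K + 1) \<le> 2 * real M" by (metis of_nat_le_iff of_nat_mult of_nat_numeral)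
      have "of_nat n * b' * a * of_nat M =
          - (b * d * of_nat (K + 1) + b * b' * of_nat M + of_nat n * (b * b') * of_nat (K + 1))"
        using w by (simp add: algebra_simps eq_neg_iff_add_eq_0)
      then have "norm (of_nat n * b' * a * of_nat M) \<le> norm (b * d * of_nat (K + 1)) +
          norm (b * b' * of_nat M) + norm (of_nat n * (b * b') * of_nat (K + 1))"
        by (metis norm_minus_cancel norm_triangle_mono order_refl)
      then have "real n * R * real M \<le> P * real (K + 1) + Q * real M + real n * Q * real (K + 1)"
        by (simp only: norm_mult norm_of_nat P_def Q_def R_def mult.assoc)
      then have "real N * (real n * R * real M) \<le>
          real N * (P * real (K + 1) + Q * real M + real n * Q * real (K + 1))"
        by (rule mult_left_mono) simp
      also have "\<dots> = real N * (P * real (K + 1)) + real N * (Q * real M) + real n * Q * (real N * real (K + 1))"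
        by (simp add: algebra_simps)
      also have "\<dots> \<le> real n * (P * (2 * real M)) + real n * (Q * real M) + real n * Q * (2 * real M)"
      proof (intro add_mono)
        show "real N * (P * real (K + 1)) \<le> real n * (P * (2 * real M))"
          using PQ n K1 by (intro mult_mono[of "real N"] mult_left_mono[of "real (K + 1)"]) simp_all
        show "real N * (Q * real M) \<le> real n * (Q * real M)"
          using PQ n by (intro mult_right_mono) simp_all
        show "real n * Q * (real N * real (K + 1)) \<le> real n * Q * (2 * real M)"
          using PQ NK by (intro mult_left_mono[of "real N * real (K + 1)"]) simp_all
      qed
      also have "\<dots> = (2 * P + 3 * Q) * (real n * real M)" by (simp add: algebra_simps)
      finally have "(real N * R) * (real n * real M) \<le> (2 * P + 3 * Q) * (real n * real M)"
        by (simp only: mult_ac)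
      moreover have "real n * real M > 0" using M1 n N' by simp
      ultimately show False using NR by (metis mult_le_cancel_right_pos not_le)
    qed
  qed
  then show ?thesis by (intro exI[of _ N0]) (simp add: N0_def)
qed

section \<open>Polynomial growth contradicts a non-terminating string\<close>

context lowest_string
begin

lemma ys_x: "n \<ge> 2 \<Longrightarrow> (\<And>n. n \<ge> 2 \<Longrightarrow> c n \<noteq> 0) \<Longrightarrow> br (ys n) x = 0"
  and ys_xs1: "n \<ge> 3 \<Longrightarrow> (\<And>n. n \<ge> 2 \<Longrightarrow> c n \<noteq> 0) \<Longrightarrow> br (ys n) (xs 1) = 0"
proof -
  have *: "br (ys n) (xs k) = 0" if n: "n \<ge> k + 2" and c: "\<And>n. n \<ge> 2 \<Longrightarrow> c n \<noteq> 0" for n k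
  proof -
    obtain m where m: "n = Suc m" "k < m" using n by (cases n) auto
    have "br (xs k) (ys n) = 0" using xs_ys[OF c, of m] m by blast
    then show ?thesis using skew[OF ys_par xs_par, of n k] by simp
  qed
  show "n \<ge> 2 \<Longrightarrow> (\<And>n. n \<ge> 2 \<Longrightarrow> c n \<noteq> 0) \<Longrightarrow> br (ys n) x = 0"
    using *[of 0 n] by simp
  show "n \<ge> 3 \<Longrightarrow> (\<And>n. n \<ge> 2 \<Longrightarrow> c n \<noteq> 0) \<Longrightarrow> br (ys n) (xs 1) = 0"
    using *[of 1 n] by simp
qed

lemma ys_kills:
  assumes "br F u = 0" and "br y u = 0"
  shows "br (ys n) u = 0"
proof (induction n)
  case (Suc n)
  have "br F (br (ys n) u) = br (br F (ys n)) u + br (ys n) (br F u)"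
    by (rule jacobi_even[OF F])
  then show ?case using Suc assms by simp
qed (simp add: assms)

text \<open>The cases differ in the start vector \<open>u\<close>. If \<open>b' = 0\<close> and
  \<open>d = 0\<close>, then \<open>g\<close> acts by zero on \<open>E\<close> and \<open>x\<close>,
  and a third generator on which \<open>g\<close> acts nontrivially is taken from \<open>z\<close>.
  If \<open>b = 0\<close>, then \<open>x\<close> has \<open>h\<close>-weight zero, and
  \<open>xs 1\<close> of weight \<open>a\<close> takes its place. In the other two cases
  \<open>u = x\<close>.\<close>

lemma poly_growth_contra:
  assumes growth: "poly_growth sc br X Y"
    and E_word: "bracket_word br X Y E e" "e \<le> 2" and x_word: "bracket_word br X Y x 1"
    and c: "\<And>n. n \<ge> 2 \<Longrightarrow> c n \<noteq> 0"
    and x0: "x \<noteq> 0" and h0: "h \<noteq> 0"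
    and nontrivial: "b \<noteq> 0 \<or> b' \<noteq> 0 \<and> a \<noteq> 0"
    and z: "b' = 0 \<Longrightarrow> d = 0 \<Longrightarrow> \<exists>u l l'. bracket_word br X Y u 1 \<and> u \<noteq> 0 \<and> l' \<noteq> 0 \<and>
      br h u = sc l u \<and> br g u = sc l' u \<and> br F u = 0 \<and> br y u = 0"
  shows False
proof -
  consider (generic) "b \<noteq> 0" "b' \<noteq> 0" | (diag) "b \<noteq> 0" "b' = 0" "d \<noteq> 0"
    | (central) "b \<noteq> 0" "b' = 0" "d = 0" | (serre) "b = 0" "b' \<noteq> 0" "a \<noteq> 0"
    using nontrivial by blast
  then show False
  proof cases
    case generic
    obtain N0 where N0: "N0 \<ge> 2" "\<And>N n K M::nat. N \<ge> N0 \<Longrightarrow> n \<ge> N \<Longrightarrow> N * K \<le> M \<Longrightarrow> K = 0 \<longrightarrow> M = 0 \<Longrightarrow>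
      b * (d + of_nat K * d + of_nat M * b') + of_nat n * b' * (b + of_nat K * b + of_nat M * a) \<noteq> 0"
      using weight_estimate[OF generic, of d a] by blast
    interpret string_words sc br V0 V1 E F x y h g a b b' d q x b d N0
      by unfold_locales (use c x0 hx gx N0 ys_x[OF _ c] in auto)
    show False using not_poly_growth[OF E_word x_word x_word] growth by blast
  next
    case diag
    have "of_nat (Suc K) * (b * d) \<noteq> 0" for K using diag by (simp del: of_nat_Suc)
    then have w: "b * (d + of_nat K * d) \<noteq> 0" for K by (simp add: algebra_simps)
    \<comment> \<open>\<open>ys_x\<close> applies from index 2 on. The threshold 3 in the last case
      is where \<open>ys_xs1\<close> begins to apply, while \<open>ys_kills\<close> holds for all
      indices and \<open>N0 = 1\<close> suffices there.\<close>
    interpret string_words sc br V0 V1 E F x y h g a b b' d q x b d 2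
      by unfold_locales (use c x0 hx gx diag w ys_x[OF _ c] in auto)
    show False using not_poly_growth[OF E_word x_word x_word] growth by blast
  next
    case central
    then obtain u l l' where u: "bracket_word br X Y u 1" "u \<noteq> 0" "l' \<noteq> 0"
      "br h u = sc l u" "br g u = sc l' u" "br F u = 0" "br y u = 0"
      using z by blast
    interpret string_words sc br V0 V1 E F x y h g a b b' d q u l l' 1
      by unfold_locales (use c u central ys_kills in auto)
    show False using not_poly_growth[OF E_word x_word u(1)] growth by blast
  next
    case serre
    \<comment> \<open>The vector \<open>xs 1\<close> is detected by \<open>y\<close>: their bracket
      is \<open>- b' E\<close>, and \<open>E\<close> is nonzero because \<open>[E, F] = h\<close>
      is.\<close>
    have "E \<noteq> 0" using h0 EF by auto
    then have "br (xs 1) y \<noteq> 0" using xs_y(1) serre by simp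
    then have "xs 1 \<noteq> 0" by auto
    have w: "of_nat n * b' * (b + a + of_nat M * a) \<noteq> 0" if "n \<ge> 3" for n M
    proof -
      have "b + a + of_nat M * a = of_nat (Suc M) * a"
        using serre by (simp add: algebra_simps)
      then show ?thesis using serre that by (simp del: of_nat_Suc)
    qed
    interpret string_words sc br V0 V1 E F x y h g a b b' d q "xs 1" "b + a" "d + b'" 3
      by unfold_locales (use c serre w \<open>xs 1 \<noteq> 0\<close> h_xs[of 1] g_xs[of 1] ys_xs1[OF _ c] in \<open>auto simp del: of_nat_mult\<close>)
    have "bracket_word br X Y (xs 1) (e + 1)"
      using bracket_word.br[OF E_word(1) x_word] xs_simps(2)[of 0] by simp
    then show False using not_poly_growth[OF E_word x_word] growth by blast
  qed
qed

end

text \<open>The Cartan subalgebra enters only through a family \<open>\<rho>\<close> of commuting even elements, indexed by a set \<open>T\<close>.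
  Its index set and the functionals on it stay fixed when the algebra is replaced by a subquotient.\<close>

locale realization = lie_super sc br V0 V1
  for sc :: "complex \<Rightarrow> 'v::ab_group_add \<Rightarrow> 'v" and br V0 V1 +
  fixes T :: "'t set" and \<rho> :: "'t \<Rightarrow> 'v" and \<alpha> :: "'i::finite \<Rightarrow> 't \<Rightarrow> complex"
    and B :: "'i \<Rightarrow> 'i \<Rightarrow> complex" and q :: "'i \<Rightarrow> bool" and h X Y :: "'i \<Rightarrow> 'v"
  assumes \<rho>_even: "t \<in> T \<Longrightarrow> \<rho> t \<in> par False"
    and \<rho>_commute: "s \<in> T \<Longrightarrow> t \<in> T \<Longrightarrow> br (\<rho> s) (\<rho> t) = 0"
    and X_par: "X i \<in> par (q i)" and Y_par: "Y i \<in> par (q i)"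
    and \<rho>_X: "t \<in> T \<Longrightarrow> br (\<rho> t) (X i) = sc (\<alpha> i t) (X i)"
    and \<rho>_Y: "t \<in> T \<Longrightarrow> br (\<rho> t) (Y i) = sc (- \<alpha> i t) (Y i)"
    and \<alpha>_independent: "(\<And>t. t \<in> T \<Longrightarrow> (\<Sum>i\<in>UNIV. k i * \<alpha> i t) = 0) \<Longrightarrow> k i = 0"
    and X_Y: "br (X i) (Y j) = (if i = j then h i else 0)"
    and h_X: "br (h i) (X j) = sc (B i j) (X j)"
    and h_Y: "br (h i) (Y j) = sc (- B i j) (Y j)"
    and h_nonzero: "h i \<noteq> 0"
begin

lemma h_even: "h i \<in> par False"
  using par_br[OF X_par Y_par, of i i] by (simp add: X_Y)

lemma X_nonzero: "X i \<noteq> 0" and Y_nonzero: "Y i \<noteq> 0"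
  using X_Y[of i i] h_nonzero[of i] by auto

lemma Y_X: "br (Y i) (X j) = (if i = j then - sc (super_sign (q i) (q i)) (h i) else 0)"
  using skew[OF Y_par X_par, of i j] X_Y by simp

text \<open>For the case \<open>b' = d = 0\<close> of \<open>poly_growth_contra\<close>: being
  elemental supplies a third generator \<open>X k\<close>, which \<open>Y i\<close> and
  \<open>Y j\<close> annihilate since \<open>k\<close> differs from both.\<close>

lemma extra_row:
  assumes el: "elemental B" and "B j i = 0" and "B j j = 0"
  shows "\<exists>k. k \<noteq> i \<and> k \<noteq> j \<and> B j k \<noteq> 0"
  using assms unfolding elemental_def by metis

lemma even_string:
  assumes "\<not> q i" and "i \<noteq> j"
  shows "lowest_string sc br V0 V1 (X i) (Y i) (X j) (Y j) (h i) (h j) (B i i) (B i j) (B j i) (B j j) (q j)"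
  by unfold_locales
    (use assms X_par[of i] Y_par[of i] X_par[of j] Y_par[of j] Y_X[of i j] in
      \<open>auto simp: X_Y h_X h_Y\<close>)

lemma even_contra:
  assumes growth: "poly_growth sc br X Y" and el: "elemental B" and "\<not> q i" and ij: "i \<noteq> j"
    and c: "\<And>n. n \<ge> 2 \<Longrightarrow> of_nat n * B i j + of_nat n * (of_nat n - 1) / 2 * B i i \<noteq> 0"
    and nt: "B i j \<noteq> 0 \<or> B j i \<noteq> 0 \<and> B i i \<noteq> 0"
  shows False
proof -
  interpret lowest_string sc br V0 V1 "X i" "Y i" "X j" "Y j" "h i" "h j" "B i i" "B i j" "B j i" "B j j" "q j"
    by (rule even_string) fact+
  show False
  proof (rule poly_growth_contra[OF growth bracket_word.X _ bracket_word.X])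
    assume "B j i = 0" "B j j = 0"
    then obtain k where "k \<noteq> i" "k \<noteq> j" "B j k \<noteq> 0" using extra_row[OF el] by blast
    then show "\<exists>u l l'. bracket_word br X Y u 1 \<and> u \<noteq> 0 \<and> l' \<noteq> 0 \<and> br (h i) u = sc l u \<and>
       br (h j) u = sc l' u \<and> br (Y i) u = 0 \<and> br (Y j) u = 0"
      using bracket_word.X[of br X Y k] X_nonzero[of k] h_X Y_X by metis
  next
    fix n :: nat assume "n \<ge> 2"
    then show "c n \<noteq> 0" using c[of n] by (simp only: c_def neg_equal_0_iff_equal not_False_eq_True)
  qed (use X_nonzero h_nonzero nt in auto)
qed

end

section \<open>Odd non-isotropic indices: the pair of squares\<close>

context lie_super
begin

lemma br_square:
  assumes "x \<in> par True"
  shows "br (br x x) z = sc 2 (br x (br x z))"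
proof -
  have "br (br x x) z = br x (br x z) + br x (br x z)"
    using jacobi_left[OF assms assms, of z] by (simp add: super_sign_def)
  also have "\<dots> = sc (1 + 1) (br x (br x z))" unfolding scale_left_distrib by simp
  finally show ?thesis by simp
qed

lemma br_even_square:
  assumes "k \<in> par False" and "br k x = sc \<kappa> x"
  shows "br k (br x x) = sc (2 * \<kappa>) (br x x)"
proof -
  have "br k (br x x) = sc (\<kappa> + \<kappa>) (br x x)"
    unfolding jacobi_even[OF assms(1)] assms(2) br_simps scale_left_distrib by simp
  then show ?thesis by simp
qed

end

context realization
begin

text \<open>For odd \<open>X i\<close> one has \<open>[[X\<^sub>i, X\<^sub>i], Y\<^sub>i] = - 2
  a\<^sub>i\<^sub>i X\<^sub>i\<close>, whence
  \<open>[E, F] = - 4 a\<^sub>i\<^sub>i h\<^sub>i\<close>. The other constants combine this factor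
  with the doubled weight of a square.\<close>

lemma odd_string:
  assumes q: "q i" and ij: "i \<noteq> j"
  shows "lowest_string sc br V0 V1 (br (X i) (X i)) (br (Y i) (Y i)) (X j) (Y j)
    (sc (- 4 * B i i) (h i)) (h j) (- 8 * (B i i)\<^sup>2) (- 4 * B i i * B i j) (2 * B j i) (B j j) (q j)"
proof unfold_locales
  have Xi: "X i \<in> par True" and Yi: "Y i \<in> par True" using X_par[of i] Y_par[of i] q by simp_all
  have sgn: "super_sign (q i) (q i) = -1" using q by (simp add: super_sign_def)
  have hX': "br (X i) (h i) = - sc (B i i) (X i)"
    using skew_even[OF h_even, of i "X i"] h_X by (simp add: minus_equation_iff)
  show E: "br (X i) (X i) \<in> par False" and F: "br (Y i) (Y i) \<in> par False"
    using par_br[OF Xi Xi] par_br[OF Yi Yi] by simp_all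
  have "br (br (X i) (X i)) (Y i) = - sc (2 * B i i) (X i)"
    unfolding br_square[OF Xi] by (simp add: X_Y hX' br_simps)
  then have "br (br (X i) (X i)) (br (Y i) (Y i)) = sc (- 2 * B i i + - 2 * B i i) (h i)"
    unfolding jacobi_even[OF E] scale_left_distrib by (simp add: br_simps X_Y Y_X sgn)
  then show "br (br (X i) (X i)) (br (Y i) (Y i)) = sc (- 4 * B i i) (h i)" by simp
  show "br (br (X i) (X i)) (Y j) = 0" using ij by (simp add: br_square[OF Xi] X_Y)
  show "br (br (Y i) (Y i)) (X j) = 0" using ij by (simp add: br_square[OF Yi] Y_X)
  show "br (sc (- 4 * B i i) (h i)) (br (X i) (X i)) = sc (- 8 * (B i i)\<^sup>2) (br (X i) (X i))"
    by (simp add: br_simps br_even_square[OF h_even h_X] power2_eq_square)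
  show "br (sc (- 4 * B i i) (h i)) (br (Y i) (Y i)) = sc (- (- 8 * (B i i)\<^sup>2)) (br (Y i) (Y i))"
    by (simp add: br_simps br_even_square[OF h_even h_Y] power2_eq_square)
  show "br (h j) (br (X i) (X i)) = sc (2 * B j i) (br (X i) (X i))"
    by (rule br_even_square[OF h_even h_X])
  show "br (h j) (br (Y i) (Y i)) = sc (- (2 * B j i)) (br (Y i) (Y i))"
    by (simp add: br_even_square[OF h_even h_Y])
qed (simp_all add: X_par Y_par X_Y h_X br_simps mult.assoc)

lemma odd_contra:
  assumes growth: "poly_growth sc br X Y" and el: "elemental B"
    and q: "q i" and ij: "i \<noteq> j" and ii: "B i i \<noteq> 0"
    and c: "\<And>n. n \<ge> 2 \<Longrightarrow> B i j + of_nat (n - 1) * B i i \<noteq> 0"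
    and nt: "B i j \<noteq> 0 \<or> B j i \<noteq> 0"
  shows False
proof -
  interpret lowest_string sc br V0 V1 "br (X i) (X i)" "br (Y i) (Y i)" "X j" "Y j"
    "sc (- 4 * B i i) (h i)" "h j" "- 8 * (B i i)\<^sup>2" "- 4 * B i i * B i j" "2 * B j i" "B j j" "q j"
    by (rule odd_string) fact+
  show False
  proof (rule poly_growth_contra[OF growth bracket_word.br[OF bracket_word.X bracket_word.X] _ bracket_word.X])
    assume "2 * B j i = 0" "B j j = 0"
    then obtain k where k: "k \<noteq> i" "k \<noteq> j" "B j k \<noteq> 0" using extra_row[OF el] by auto
    have "br (br (Y i) (Y i)) (X k) = 0"
      using br_square[of "Y i" "X k"] Y_par[of i] q k by (simp add: Y_X)
    moreover have "br (sc (- 4 * B i i) (h i)) (X k) = sc (- 4 * B i i * B i k) (X k)"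
      by (simp add: br_simps h_X mult.assoc)
    ultimately show "\<exists>u l l'. bracket_word br X Y u 1 \<and> u \<noteq> 0 \<and> l' \<noteq> 0 \<and>
       br (sc (- 4 * B i i) (h i)) u = sc l u \<and>
       br (h j) u = sc l' u \<and> br (br (Y i) (Y i)) u = 0 \<and> br (Y j) u = 0"
      using bracket_word.X[of br X Y k] X_nonzero[of k] h_X[of j k] Y_X[of j k] k by metis
  next
    fix n :: nat assume n: "n \<ge> 2"
    \<comment> \<open>A zero of \<open>c\<close> now means
      \<open>a\<^sub>i\<^sub>j = - (n - 1) a\<^sub>i\<^sub>i\<close>, whereas an even index gives
      half of that. This is the origin of the factor \<open>2^p(i)\<close> in (C3).\<close>
    have "c n = of_nat n * (4 * B i i) * (B i j + of_nat (n - 1) * B i i)"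
      using n unfolding c_def by (simp add: of_nat_diff power2_eq_square field_simps)
    then show "c n \<noteq> 0" using c[OF n] n ii by simp
  qed (use X_nonzero h_nonzero nt ii in auto)
qed

text \<open>Scaling makes each nonzero diagonal entry 2. A violation of (C2), (C3) or (C4) leaves no
  zero of \<open>c\<close> at \<open>n \<ge> 2\<close>: for (C2) since
  \<open>c n = - n a\<^sub>i\<^sub>j\<close>, for (C3) since a zero would put
  \<open>a\<^sub>i\<^sub>j\<close> into the allowed set, for (C4) since \<open>c n\<close> reduces
  to its nonzero \<open>a\<^sub>i\<^sub>i\<close> term.\<close>

theorem conds_of_poly_growth:
  assumes growth: "poly_growth sc br X Y" and el: "elemental B"
  shows "satisfies_C1_C4_up_to_rows B q"
proof -
  define r where "r i = (if B i i = 0 then 1 else 2 / B i i)" for i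
  have r: "r i \<noteq> 0" for i by (simp add: r_def)
  have diag: "r i * B i i = (if B i i = 0 then 0 else 2)" for i by (simp add: r_def)
  have C2: "q i" if "B i i = 0" for i
  proof (rule ccontr)
    assume "\<not> q i"
    obtain j where "B i j \<noteq> 0" using el by (auto simp: elemental_def)
    then show False using even_contra[OF growth el \<open>\<not> q i\<close>, of j] that by force
  qed
  have C3: "\<exists>m::nat. r i * B i j = - (of_nat m * (if q i then 2 else 1))"
    if "B i i \<noteq> 0" "j \<noteq> i" for i j
  proof (rule ccontr)
    assume no: "\<not> ?thesis"
    have ij: "B i j \<noteq> 0" using no by (metis mult_zero_left mult_zero_right neg_0_equal_iff_equal of_nat_0)
    show False
    proof (cases "q i")
      case True
      show False
      proof (rule odd_contra[OF growth el True])
        fix n :: nat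
        show "B i j + of_nat (n - 1) * B i i \<noteq> 0"
        proof
          assume "B i j + of_nat (n - 1) * B i i = 0"
          then have "B i j = - (of_nat (n - 1) * B i i)" by (simp only: eq_neg_iff_add_eq_0)
          then have "r i * B i j = - (of_nat (n - 1) * 2)" using that by (simp add: r_def)
          with no True show False by auto
        qed
      qed (use that ij in auto)
    next
      case False
      show False
      proof (rule even_contra[OF growth el False])
        fix n :: nat assume n: "n \<ge> 2"
        show "of_nat n * B i j + of_nat n * (of_nat n - 1) / 2 * B i i \<noteq> 0"
        proof
          assume "of_nat n * B i j + of_nat n * (of_nat n - 1) / 2 * B i i = 0"
          then have "of_nat n * (B i j + of_nat (n - 1) / 2 * B i i) = 0"
            using n by (simp add: of_nat_diff algebra_simps)
          then have "B i j + of_nat (n - 1) / 2 * B i i = 0" using n by simp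
          then have "B i j = - (of_nat (n - 1) / 2 * B i i)" by (simp only: eq_neg_iff_add_eq_0)
          then have "r i * B i j = - of_nat (n - 1)" using that by (simp add: r_def)
          with no False show False by auto
        qed
      qed (use that ij in auto)
    qed
  qed
  have C4: "B i i = 0" if "B i j = 0" "B j i \<noteq> 0" for i j
  proof (rule ccontr)
    assume ii: "B i i \<noteq> 0"
    with that have ij: "i \<noteq> j" by auto
    show False
    proof (cases "q i")
      case True
      show False
        by (rule odd_contra[OF growth el True ij ii]) (use that ii in auto)
    next
      case False
      show False
        by (rule even_contra[OF growth el False ij]) (use that ii in auto)
    qed
  qed
  have "conds_C1_C4 (\<lambda>i j. r i * B i j) q"
    unfolding conds_C1_C4_def diag using C2 C3 r
    by (auto split: if_splits) (metis C4)
  then show ?thesis using r unfolding satisfies_C1_C4_up_to_rows_def by blast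
qed

end

section \<open>Subquotients of a Lie superalgebra\<close>

text \<open>The quotient has to live on the same type, so \<open>S / K\<close> is modelled by a
  complement of \<open>K\<close> in \<open>S\<close>: a basis of \<open>K\<close> is extended to one
  of \<open>S\<close> and then sent to zero. The range clause of the extension puts the images of
  vectors outside \<open>S\<close> into \<open>S\<close> as well.\<close>

lemma (in vector_space) projection_modulo:
  assumes K: "subspace K" and S: "subspace S" and KS: "K \<subseteq> S"
  shows "\<exists>\<pi>. Vector_Spaces.linear scale scale \<pi> \<and> (\<forall>v. \<pi> v \<in> S) \<and> (\<forall>v\<in>S. \<pi> v - v \<in> K) \<and> (\<forall>v\<in>K. \<pi> v = 0)"
proof -
  interpret vector_space_pair scale scale by unfold_locales
  obtain BK where BK: "BK \<subseteq> K" "independent BK" "K \<subseteq> span BK"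
    using maximal_independent_subset[of K] by blast
  obtain BS where BS: "BK \<subseteq> BS" "BS \<subseteq> S" "independent BS" "S \<subseteq> span BS"
    using maximal_independent_subset_extend[of BK S] BK KS by blast
  obtain \<pi> where \<pi>: "Vector_Spaces.linear scale scale \<pi>"
    "\<And>b. b \<in> BS \<Longrightarrow> \<pi> b = (if b \<in> BK then 0 else b)"
    "range \<pi> = span ((\<lambda>b. if b \<in> BK then 0 else b) ` BS)"
    using linear_independent_extend_subspace[OF BS(3), of "\<lambda>b. if b \<in> BK then 0 else b"] by blast
  interpret \<pi>: Vector_Spaces.linear scale scale \<pi> by fact
  have "\<pi> v \<in> S" for v
  proof -
    have "(\<lambda>b. if b \<in> BK then 0 else b) ` BS \<subseteq> S" using BS(2) subspace_0[OF S] by auto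
    then have "range \<pi> \<subseteq> S" using \<pi>(3) span_minimal[OF _ S] by simp
    then show ?thesis by blast
  qed
  moreover have "\<pi> v - v \<in> K" if "v \<in> S" for v
  proof -
    have "v \<in> span BS" using that BS(4) by blast
    then show ?thesis
    proof (induction rule: span_induct_alt)
      case base show ?case using K by (simp add: subspace_0 \<pi>.zero)
    next
      case (step k x y)
      have "\<pi> x - x \<in> K" using \<pi>(2)[OF step(1)] BK(1) K by (auto simp: subspace_0 subspace_neg)
      then have "scale k (\<pi> x - x) + (\<pi> y - y) \<in> K"
        using step(2) K by (intro subspace_add subspace_scale)
      also have "scale k (\<pi> x - x) + (\<pi> y - y) = \<pi> (scale k x + y) - (scale k x + y)"
        by (simp add: \<pi>.add \<pi>.scale algebra_simps)
      finally show ?case .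
    qed
  qed
  moreover have "\<pi> v = 0" if "v \<in> K" for v
  proof -
    have "v \<in> span BK" using that BK(3) by blast
    then show ?thesis
    proof (induction rule: span_induct_alt)
      case base show ?case by (rule \<pi>.zero)
    next
      case (step k x y)
      then show ?case using \<pi>(2)[of x] BS(1) by (auto simp: \<pi>.add \<pi>.scale)
    qed
  qed
  ultimately show ?thesis using \<pi>(1) by blast
qed

context lie_super
begin

lemma parity_projection:
  "\<exists>P. Vector_Spaces.linear sc sc P \<and> (\<forall>v. P v \<in> par False) \<and> (\<forall>v. v - P v \<in> par True) \<and>
     (\<forall>v\<in>par False. P v = v) \<and> (\<forall>v\<in>par True. P v = 0)"
proof -
  have "\<forall>v. \<exists>a. a \<in> par False \<and> v - a \<in> par True"
  proof
    fix v
    obtain a b where "a \<in> par False" "b \<in> par True" "v = a + b" by (rule par_decomp)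
    then show "\<exists>a. a \<in> par False \<and> v - a \<in> par True" by (intro exI[of _ a]) simp
  qed
  then obtain P where P: "\<And>v. P v \<in> par False" "\<And>v. v - P v \<in> par True" by metis
  have unique: "P v = a" if "a \<in> par False" "v - a \<in> par True" for a v
  proof -
    have "P v - a \<in> par False" using P(1) that(1) by (rule subspace_diff[OF subspace_par])
    moreover have "(v - a) - (v - P v) \<in> par True" using that(2) P(2) by (rule subspace_diff[OF subspace_par])
    then have "P v - a \<in> par True" by simp
    ultimately show ?thesis using par_disjoint by fastforce
  qed
  have add: "P (x + y) = P x + P y" for x y
    by (rule unique) (use subspace_add[OF subspace_par P(1) P(1), of x y]
      subspace_add[OF subspace_par P(2) P(2), of x y] in \<open>simp_all add: algebra_simps\<close>)
  have scale: "P (sc k x) = sc k (P x)" for k x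
    by (rule unique) (use subspace_scale[OF subspace_par P(1), of k x]
      subspace_scale[OF subspace_par P(2), of k x] in \<open>simp_all add: scale_right_diff_distrib\<close>)
  have "Vector_Spaces.linear sc sc P" by unfold_locales (simp_all add: add scale)
  then show ?thesis
    using P unique subspace_0[OF subspace_par] by (intro exI[of _ P]) auto
qed

text \<open>\<open>projection_modulo\<close> is applied to the even and the odd parts separately,
  and the two maps are glued along the parity projection. This works because the span of homogeneous
  vectors contains the parity components of its elements.\<close>

lemma graded_projection:
  assumes WK: "WK \<subseteq> par False \<union> par True" and WS: "WS \<subseteq> par False \<union> par True"
    and KS: "span WK \<subseteq> span WS"
  shows "\<exists>\<pi>. Vector_Spaces.linear sc sc \<pi> \<and> (\<forall>v. \<pi> v \<in> span WS) \<and>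
    (\<forall>v\<in>span WS. \<pi> v - v \<in> span WK) \<and> (\<forall>v\<in>span WK. \<pi> v = 0) \<and> (\<forall>b. \<forall>v\<in>par b. \<pi> v \<in> par b)"
proof -
  obtain P where P: "Vector_Spaces.linear sc sc P" "\<And>v. P v \<in> par False" "\<And>v. v - P v \<in> par True"
    "\<And>v. v \<in> par False \<Longrightarrow> P v = v" "\<And>v. v \<in> par True \<Longrightarrow> P v = 0"
    using parity_projection by blast
  interpret P: Vector_Spaces.linear sc sc P by fact
  have graded: "P v \<in> span W" if W: "W \<subseteq> par False \<union> par True" and v: "v \<in> span W" for W v
    using v
  proof (induction rule: span_induct_alt)
    case base show ?case by (simp add: P.zero span_zero)
  next
    case (step k x y)
    have "P x \<in> span W" using step(1) W P(4,5)[of x] by (auto simp: span_base span_zero)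
    then show ?case using step(2) by (simp add: P.add P.scale span_add span_scale)
  qed
  have "\<exists>\<pi>. Vector_Spaces.linear sc sc \<pi> \<and> (\<forall>v. \<pi> v \<in> span WS \<inter> par b) \<and>
    (\<forall>v\<in>span WS \<inter> par b. \<pi> v - v \<in> span WK \<inter> par b) \<and> (\<forall>v\<in>span WK \<inter> par b. \<pi> v = 0)" for b
    by (rule projection_modulo) (use KS in \<open>auto intro: subspace_inter subspace_par\<close>)
  then obtain \<pi> where \<pi>: "\<And>b. Vector_Spaces.linear sc sc (\<pi> b)" "\<And>b v. \<pi> b v \<in> span WS \<inter> par b"
    "\<And>b v. v\<in>span WS \<inter> par b \<Longrightarrow> \<pi> b v - v \<in> span WK \<inter> par b"
    "\<And>b v. v\<in>span WK \<inter> par b \<Longrightarrow> \<pi> b v = 0"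
    by metis
  interpret p0: Vector_Spaces.linear sc sc "\<pi> False" by (rule \<pi>)
  interpret p1: Vector_Spaces.linear sc sc "\<pi> True" by (rule \<pi>)
  define p where "p v = \<pi> False (P v) + \<pi> True (v - P v)" for v
  have "Vector_Spaces.linear sc sc p"
    by unfold_locales
      (simp_all add: p_def P.add P.scale p0.add p1.add p0.scale p1.scale p0.diff p1.diff algebra_simps)
  moreover have "p v \<in> span WS" for v
    using \<pi>(2) by (auto simp: p_def intro: span_add)
  moreover have "p v - v \<in> span WK" if v: "v \<in> span WS" for v
  proof -
    have "P v \<in> span WS \<inter> par False" "v - P v \<in> span WS \<inter> par True"
      using graded[OF WS v] v P(2,3) by (auto intro: span_diff)
    then have "(\<pi> False (P v) - P v) + (\<pi> True (v - P v) - (v - P v)) \<in> span WK"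
      using \<pi>(3) by (blast intro: span_add)
    then show ?thesis by (simp add: p_def algebra_simps)
  qed
  moreover have "p v = 0" if v: "v \<in> span WK" for v
  proof -
    have "P v \<in> span WK \<inter> par False" "v - P v \<in> span WK \<inter> par True"
      using graded[OF WK v] v P(2,3) by (auto intro: span_diff)
    then show ?thesis using \<pi>(4) by (simp add: p_def)
  qed
  moreover have "p v \<in> par b" if "v \<in> par b" for b v
    using that \<pi>(2) P(4,5)[of v] by (cases b) (auto simp: p_def p0.zero p1.zero)
  ultimately show ?thesis by blast
qed

text \<open>Since \<open>\<pi>\<close> lands in the subalgebra and moves its elements only by
  elements of the ideal, an inner \<open>\<pi>\<close> disappears under an outer one, and the axioms
  are inherited from \<open>br\<close> on the whole type. The doubled \<open>\<pi>\<close> in the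
  last clause arises because elements of the quotient are represented by
  \<open>\<pi> x\<close>.\<close>

lemma subquotient:
  assumes WK: "WK \<subseteq> par False \<union> par True" and WS: "WS \<subseteq> par False \<union> par True"
    and KS: "span WK \<subseteq> span WS"
    and S: "\<And>x y. x \<in> span WS \<Longrightarrow> y \<in> span WS \<Longrightarrow> br x y \<in> span WS"
    and K: "\<And>x u. x \<in> span WS \<Longrightarrow> u \<in> span WK \<Longrightarrow> br x u \<in> span WK \<and> br u x \<in> span WK"
  shows "\<exists>\<pi>. Vector_Spaces.linear sc sc \<pi> \<and>
    (\<forall>v\<in>span WS. \<pi> v = 0 \<longleftrightarrow> v \<in> span WK) \<and> (\<forall>b. \<forall>v\<in>par b. \<pi> v \<in> par b) \<and>
    lie_super sc (\<lambda>x y. \<pi> (br (\<pi> x) (\<pi> y))) V0 V1 \<and>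
    (\<forall>x\<in>span WS. \<forall>y\<in>span WS. \<pi> (br (\<pi> (\<pi> x)) (\<pi> (\<pi> y))) = \<pi> (br x y))"
proof -
  obtain \<pi> where lin: "Vector_Spaces.linear sc sc \<pi>" and range: "\<And>v. \<pi> v \<in> span WS"
    and mod: "\<And>v. v \<in> span WS \<Longrightarrow> \<pi> v - v \<in> span WK" and ker: "\<And>v. v \<in> span WK \<Longrightarrow> \<pi> v = 0"
    and par: "\<And>b v. v \<in> par b \<Longrightarrow> \<pi> v \<in> par b"
    using graded_projection[OF WK WS KS] by blast
  interpret \<pi>: Vector_Spaces.linear sc sc \<pi> by fact
  have cong: "\<pi> x = \<pi> y" if "x - y \<in> span WK" for x y
    using ker[OF that] by (simp add: \<pi>.diff)
  have right: "\<pi> (br x (\<pi> y)) = \<pi> (br x y)" if "x \<in> span WS" "y \<in> span WS" for x y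
    using cong[of "br x (\<pi> y)" "br x y"] K[OF that(1) mod[OF that(2)]] by (simp add: br_diff_right)
  have left: "\<pi> (br (\<pi> x) y) = \<pi> (br x y)" if "x \<in> span WS" "y \<in> span WS" for x y
    using cong[of "br (\<pi> x) y" "br x y"] K[OF that(2) mod[OF that(1)]] by (simp add: br_diff_left)
  have idem: "\<pi> (\<pi> x) = \<pi> x" if "x \<in> span WS" for x by (rule cong[OF mod[OF that]])
  let ?br = "\<lambda>x y. \<pi> (br (\<pi> x) (\<pi> y))"
  have "lie_superalgebra sc ?br V0 V1"
    unfolding lie_superalgebra_def
  proof (intro conjI allI impI)
    show "vector_space sc" by unfold_locales
    show "subspace V0" "subspace V1" using subspace_par[of False] subspace_par[of True] by (simp_all add: par_part_def)
    show "V0 \<inter> V1 = {0}"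
      using par_disjoint subspace_0[OF subspace_par, of False] subspace_0[OF subspace_par, of True]
      by (auto simp: par_part_def)
    show "\<exists>a\<in>V0. \<exists>b\<in>V1. v = a + b" for v
      by (rule par_decomp[of v]) (auto simp: par_part_def)
    show "?br x y \<in> par (a \<noteq> b)" if "x \<in> par a" "y \<in> par b" for a b x y
      using that by (intro par par_br)
    show "?br x y = - sc (super_sign a b) (?br y x)" if "x \<in> par a" "y \<in> par b" for a b x y
      using skew[OF par[OF that(1)] par[OF that(2)]] by (simp add: \<pi>.neg \<pi>.scale)
    show "?br x (?br y z) = ?br (?br x y) z + sc (super_sign a b) (?br y (?br x z))"
      if "x \<in> par a" "y \<in> par b" for a b x y z
      unfolding idem[OF S[OF range range]] right[OF range S[OF range range]] left[OF S[OF range range] range]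
      by (simp only: jacobi[OF par[OF that(1)] par[OF that(2)]] \<pi>.add \<pi>.scale)
    show "?br (x + y) z = ?br x z + ?br y z" "?br x (y + z) = ?br x y + ?br x z" for x y z
      by (simp_all only: \<pi>.add br_add_left br_add_right)
    show "?br (sc k x) y = sc k (?br x y)" "?br x (sc k y) = sc k (?br x y)" for k x y
      by (simp_all only: \<pi>.scale br_scale_left br_scale_right)
  qed
  then have "lie_super sc ?br V0 V1" by (rule lie_super.intro)
  moreover have "\<pi> v = 0 \<longleftrightarrow> v \<in> span WK" if "v \<in> span WS" for v
    using ker mod[OF that] span_neg by fastforce
  moreover have "\<pi> (br (\<pi> (\<pi> x)) (\<pi> (\<pi> y))) = \<pi> (br x y)" if "x \<in> span WS" "y \<in> span WS" for x y
    unfolding idem[OF that(1)] idem[OF that(2)] right[OF range that(2)] left[OF that] ..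
  ultimately show ?thesis using lin par by blast
qed

end

section \<open>Killing the singular brackets\<close>

text \<open>The brackets \<open>[X\<^sub>k, X\<^sub>i]\<close> required to vanish for the reflection
  at \<open>k\<close>. Every \<open>Y j\<close> annihilates them (base case of
  \<open>Y_singular_word\<close>), which keeps the ideal they generate away from weight
  zero.\<close>

definition singular_pair :: "('i \<Rightarrow> 'i \<Rightarrow> complex) \<Rightarrow> ('i \<Rightarrow> bool) \<Rightarrow> 'i \<Rightarrow> 'i \<Rightarrow> bool" where
  "singular_pair B q k i \<longleftrightarrow> (i = k \<and> isotropic B q k) \<or> (i \<noteq> k \<and> B i k = 0 \<and> B k i = 0)"

text \<open>Here \<open>n\<close> counts the occurrences of each generator, so the weight of the
  word is the sum of the \<open>n j \<alpha> j\<close>. Together with the same words in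
  \<open>Y\<close>, these span the ideal to be divided out.\<close>

inductive singular_word ::
  "('v \<Rightarrow> 'v \<Rightarrow> 'v) \<Rightarrow> ('i \<Rightarrow> 'i \<Rightarrow> complex) \<Rightarrow> ('i \<Rightarrow> bool) \<Rightarrow> ('i \<Rightarrow> 'v) \<Rightarrow> 'v \<Rightarrow> ('i \<Rightarrow> nat) \<Rightarrow> bool"
  for br B q X where
  base: "singular_pair B q k i \<Longrightarrow>
    singular_word br B q X (br (X k) (X i)) (\<lambda>j. of_bool (j = k) + of_bool (j = i))"
| step: "singular_word br B q X u n \<Longrightarrow> singular_word br B q X (br (X j) u) (n(j := Suc (n j)))"

text \<open>Spans the subalgebra generated by \<open>\<rho>\<close>, \<open>X\<close> and
  \<open>Y\<close>; the recorded parity makes this span graded, as the subquotient construction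
  requires.\<close>

inductive homogeneous_word ::
  "('v \<Rightarrow> 'v \<Rightarrow> 'v) \<Rightarrow> 't set \<Rightarrow> ('t \<Rightarrow> 'v) \<Rightarrow> ('i \<Rightarrow> bool) \<Rightarrow> ('i \<Rightarrow> 'v) \<Rightarrow> ('i \<Rightarrow> 'v) \<Rightarrow> 'v \<Rightarrow> bool \<Rightarrow> bool"
  for br T \<rho> q X Y where
  \<rho>: "t \<in> T \<Longrightarrow> homogeneous_word br T \<rho> q X Y (\<rho> t) False"
| X: "homogeneous_word br T \<rho> q X Y (X i) (q i)"
| Y: "homogeneous_word br T \<rho> q X Y (Y i) (q i)"
| br: "homogeneous_word br T \<rho> q X Y u a \<Longrightarrow> homogeneous_word br T \<rho> q X Y w b \<Longrightarrow>
    homogeneous_word br T \<rho> q X Y (br u w) (a \<noteq> b)"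

lemma singular_word_nonzero: "singular_word br B q X u n \<Longrightarrow> \<exists>j. n j \<noteq> 0"
proof (induction rule: singular_word.induct)
  case (base k i) show ?case by (intro exI[of _ k]) simp
next
  case (step u n j) show ?case by (intro exI[of _ j]) simp
qed

lemma singular_word_homogeneous:
  "singular_word br B q X u n \<Longrightarrow> \<exists>b. homogeneous_word br T \<rho> q X Y u b"
  "singular_word br B q Y u n \<Longrightarrow> \<exists>b. homogeneous_word br T \<rho> q X Y u b"
  by (induction rule: singular_word.induct; blast intro: homogeneous_word.intros)+

lemma bracket_word_homogeneous: "bracket_word br X Y u n \<Longrightarrow> \<exists>b. homogeneous_word br T \<rho> q X Y u b"
  by (induction rule: bracket_word.induct) (blast intro: homogeneous_word.intros)+

text \<open>Vectors killed by a product of operators \<open>ad (\<rho> t) - c\<close> with \<open>c \<noteq> 0\<close>, hence without weight-zero component.\<close>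

inductive no_zero_weight :: "(complex \<Rightarrow> 'v::ab_group_add \<Rightarrow> 'v) \<Rightarrow> ('v \<Rightarrow> 'v \<Rightarrow> 'v) \<Rightarrow> 't set \<Rightarrow> ('t \<Rightarrow> 'v) \<Rightarrow> 'v \<Rightarrow> bool"
  for sc br T \<rho> where
  zero: "no_zero_weight sc br T \<rho> 0"
| step: "t \<in> T \<Longrightarrow> c \<noteq> 0 \<Longrightarrow> no_zero_weight sc br T \<rho> (br (\<rho> t) x - sc c x) \<Longrightarrow> no_zero_weight sc br T \<rho> x"

context realization
begin

abbreviation "nzw \<equiv> no_zero_weight sc br T \<rho>"

lemma \<rho>_\<rho>: "s \<in> T \<Longrightarrow> t \<in> T \<Longrightarrow> br (\<rho> s) (br (\<rho> t) x) = br (\<rho> t) (br (\<rho> s) x)"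
  using jacobi_even[OF \<rho>_even, of s "\<rho> t" x] \<rho>_commute by simp

text \<open>The operators \<open>ad (\<rho> s) - k\<close> and \<open>ad (\<rho> t) - c\<close>
  commute. In \<open>nzw_add\<close> this allows the operators that annihilate one summand to be
  applied to the other.\<close>

lemma nzw_image:
  assumes "nzw x" and s: "s \<in> T"
  shows "nzw (br (\<rho> s) x - sc k x)"
  using assms(1)
proof (induction rule: no_zero_weight.induct)
  case zero show ?case by (simp add: no_zero_weight.zero)
next
  case (step t c x)
  have "br (\<rho> s) (br (\<rho> t) x - sc c x) - sc k (br (\<rho> t) x - sc c x) =
      br (\<rho> t) (br (\<rho> s) x - sc k x) - sc c (br (\<rho> s) x - sc k x)"
    by (simp add: br_simps \<rho>_\<rho>[OF s step(1)] scale_right_diff_distrib mult.commute algebra_simps)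
  with step.IH show ?case using no_zero_weight.step[OF step(1,2)] by metis
qed

lemma nzw_add:
  assumes "nzw x" and "nzw y"
  shows "nzw (x + y)"
  using assms
proof (induction arbitrary: y rule: no_zero_weight.induct)
  case (step t c x)
  have "nzw ((br (\<rho> t) x - sc c x) + (br (\<rho> t) y - sc c y))"
    using step.IH nzw_image[OF step.prems step.hyps(1)] by blast
  then have "nzw (br (\<rho> t) (x + y) - sc c (x + y))"
    by (simp add: br_simps scale_right_distrib algebra_simps)
  then show ?case using no_zero_weight.step[OF step(1,2)] by blast
qed simp

lemma nzw_scale: "nzw x \<Longrightarrow> nzw (sc k x)"
proof (induction rule: no_zero_weight.induct)
  case (step t c x)
  then have "nzw (br (\<rho> t) (sc k x) - sc c (sc k x))"
    by (simp add: br_simps scale_right_diff_distrib mult.commute)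
  then show ?case using no_zero_weight.step[OF step(1,2)] by blast
qed (simp add: no_zero_weight.zero)

text \<open>On a vector of weight zero every operator in the annihilating product acts as a nonzero
  scalar \<open>- c\<close>.\<close>

lemma nzw_weight_zero: "nzw x \<Longrightarrow> (\<And>t. t \<in> T \<Longrightarrow> br (\<rho> t) x = 0) \<Longrightarrow> x = 0"
proof (induction rule: no_zero_weight.induct)
  case (step t c x)
  have "br (\<rho> t) x - sc c x = 0"
    using step by (intro step.IH) (simp add: br_simps)
  then show ?case using step by simp
qed simp

lemma homogeneous_word_par: "homogeneous_word br T \<rho> q X Y u b \<Longrightarrow> u \<in> par b"
proof (induction rule: homogeneous_word.induct)
  case (br u a w b) then show ?case by (intro par_br)
qed (simp_all add: \<rho>_even X_par Y_par)

text \<open>Exchanging \<open>X\<close> and \<open>Y\<close> replaces \<open>h i\<close> by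
  \<open>[Y\<^sub>i, X\<^sub>i]\<close>, which is \<open>h i\<close> up to the sign
  \<open>- super_sign (q i) (q i)\<close>; with the negated weights this gives the sign on row
  \<open>i\<close>. Facts about words in \<open>X\<close> thereby transfer to words in
  \<open>Y\<close>.\<close>

lemma dual: "realization sc br V0 V1 T \<rho> (\<lambda>i t. - \<alpha> i t) (\<lambda>i j. super_sign (q i) (q i) * B i j) q
    (\<lambda>i. br (Y i) (X i)) Y X"
proof unfold_locales
  show "k i = 0" if "\<And>t. t \<in> T \<Longrightarrow> (\<Sum>i\<in>UNIV. k i * - \<alpha> i t) = 0" for k i
    using \<alpha>_independent[of k i] that by (simp add: sum_negf)
  show "br (Y i) (X i) \<noteq> 0" for i
    using h_nonzero by (simp add: Y_X super_sign_def)
qed (simp_all add: \<rho>_even \<rho>_commute X_par Y_par \<rho>_X \<rho>_Y Y_X h_X h_Y br_simps)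

lemma singular_pair_dual: "singular_pair (\<lambda>i j. super_sign (q i) (q i) * B i j) q = singular_pair B q"
  by (intro ext) (auto simp: singular_pair_def isotropic_def super_sign_def)

lemma singular_word_dual:
  "singular_word br (\<lambda>i j. super_sign (q i) (q i) * B i j) q Z u n \<longleftrightarrow> singular_word br B q Z u n"
proof -
  have "singular_word br B' q' Z u n \<Longrightarrow> singular_pair B' q' = singular_pair B'' q' \<Longrightarrow> singular_word br B'' q' Z u n"
    for B' B'' :: "'i \<Rightarrow> 'i \<Rightarrow> complex" and q'
    by (induction rule: singular_word.induct) (auto intro: singular_word.intros)
  then show ?thesis using singular_pair_dual by metis
qed

lemma singular_word_weight:
  assumes "singular_word br B q X u n" and z: "z \<in> par False" and zX: "\<And>j. br z (X j) = sc (\<mu> j) (X j)"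
  shows "br z u = sc (\<Sum>j\<in>UNIV. of_nat (n j) * \<mu> j) u"
  using assms(1)
proof (induction rule: singular_word.induct)
  case (base k i)
  have "(\<Sum>j\<in>UNIV. of_nat (of_bool (j = k) + of_bool (j = i)) * \<mu> j) =
      (\<Sum>j\<in>UNIV. (if j = k then \<mu> j else 0) + (if j = i then \<mu> j else 0))"
    by (rule sum.cong) auto
  then have eq: "(\<Sum>j\<in>UNIV. of_nat (of_bool (j = k) + of_bool (j = i)) * \<mu> j) = \<mu> k + \<mu> i"
    by (simp add: sum.distrib)
  show ?case unfolding eq jacobi_even[OF z] zX br_simps by (simp add: scale_left_distrib)
next
  case (step u n j)
  have "(\<Sum>l\<in>UNIV. of_nat ((n(j := Suc (n j))) l) * \<mu> l) =
      (\<Sum>l\<in>UNIV. of_nat (n l) * \<mu> l + (if l = j then \<mu> l else 0))"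
    by (rule sum.cong) (auto simp: algebra_simps)
  also have "\<dots> = (\<Sum>l\<in>UNIV. of_nat (n l) * \<mu> l) + \<mu> j" by (simp add: sum.distrib)
  finally have eq: "(\<Sum>l\<in>UNIV. of_nat ((n(j := Suc (n j))) l) * \<mu> l) = (\<Sum>l\<in>UNIV. of_nat (n l) * \<mu> l) + \<mu> j" .
  show ?case unfolding eq jacobi_even[OF z] zX br_simps step.IH by (simp add: scale_left_distrib)
qed

text \<open>Moving \<open>Y j\<close> inwards past \<open>ad (X l)\<close> leaves a Cartan element
  acting on a weight vector, hence a multiple of a shorter word. At the innermost bracket the result
  is zero by the entries of a singular pair.\<close>

lemma Y_singular_word:
  assumes "singular_word br B q X u n"
  shows "br (Y j) u \<in> span {u. \<exists>n. singular_word br B q X u n}" (is "_ \<in> span ?W")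
  using assms
proof (induction rule: singular_word.induct)
  case (base k i)
  have hX': "br (X k) (h i) = - sc (B i k) (X k)" for i k
    using skew_even[OF h_even, of i "X k"] h_X by (simp add: minus_equation_iff)
  have "br (Y j) (br (X k) (X i)) = br (br (Y j) (X k)) (X i) + sc (super_sign (q j) (q k)) (br (X k) (br (Y j) (X i)))"
    by (rule jacobi[OF Y_par X_par])
  also have "\<dots> = 0"
    using base by (auto simp: Y_X br_simps h_X hX' singular_pair_def isotropic_def)
  finally show ?case by (simp add: span_zero)
next
  case (step u n l)
  have h: "br (h j) u \<in> span ?W"
    unfolding singular_word_weight[OF step(1) h_even h_X, of j]
    using step(1) by (intro span_scale span_base) blast
  have X: "br (X l) w \<in> span ?W" if "w \<in> span ?W" for w
    using that
  proof (induction rule: span_induct_alt)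
    case base show ?case by (simp add: span_zero)
  next
    case (step k x y)
    from step(1) have "br (X l) x \<in> span ?W" by (blast intro: span_base singular_word.step)
    then show ?case using step(2) by (simp add: br_simps span_add span_scale)
  qed
  have "br (Y j) (br (X l) u) = br (br (Y j) (X l)) u + sc (super_sign (q j) (q l)) (br (X l) (br (Y j) u))"
    by (rule jacobi[OF Y_par X_par])
  moreover have "br (br (Y j) (X l)) u \<in> span ?W"
  proof (cases "j = l")
    case True
    then have "br (br (Y j) (X l)) u = - sc (super_sign (q j) (q j)) (br (h j) u)"
      by (simp add: Y_X br_simps)
    then show ?thesis using span_neg[OF span_scale[OF h]] by metis
  qed (simp add: Y_X span_zero)
  ultimately show ?case using X[OF step.IH] by (simp add: span_add span_scale)
qed

lemma X_singular_word:
  assumes "singular_word br B q Y u n"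
  shows "br (X j) u \<in> span {u. \<exists>n. singular_word br B q Y u n}"
  using realization.Y_singular_word[OF dual, of u n j] assms by (simp add: singular_word_dual)

text \<open>The weight is nonzero at some \<open>t\<close>, as the \<open>\<alpha> i\<close> are
  independent and \<open>n\<close> is not identically zero; a single operator then annihilates the
  word.\<close>

lemma singular_word_nzw:
  assumes "singular_word br B q X u n \<or> singular_word br B q Y u n"
  shows "nzw u"
proof -
  obtain j where "n j \<noteq> 0" using assms singular_word_nonzero by metis
  then obtain t where t: "t \<in> T" "(\<Sum>i\<in>UNIV. of_nat (n i) * \<alpha> i t) \<noteq> 0"
    using \<alpha>_independent[of "\<lambda>i. of_nat (n i)" j] by auto
  from assms obtain c where c: "c \<noteq> 0" "br (\<rho> t) u = sc c u"
  proof
    assume "singular_word br B q X u n"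
    from singular_word_weight[OF this \<rho>_even[OF t(1)] \<rho>_X[OF t(1)]] t(2) show thesis using that by blast
  next
    assume "singular_word br B q Y u n"
    then have "br (\<rho> t) u = sc (\<Sum>i\<in>UNIV. of_nat (n i) * - \<alpha> i t) u"
      using realization.singular_word_weight[OF dual, of u n "\<rho> t" "\<lambda>i. - \<alpha> i t"] \<rho>_even \<rho>_Y t(1)
      by (simp add: singular_word_dual)
    then show thesis
      using that[of "- (\<Sum>i\<in>UNIV. of_nat (n i) * \<alpha> i t)"] t(2) by (simp add: sum_negf)
  qed
  then show ?thesis using no_zero_weight.step[OF t(1) c(1), of sc br \<rho> u] by (simp add: no_zero_weight.zero)
qed

end

section \<open>The reduced quotient of a realization\<close>

context realization
begin

theorem reduced_quotient:
  assumes growth: "poly_growth sc br X Y"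
  shows "\<exists>br' \<rho>' h' X' Y'. realization sc br' V0 V1 T \<rho>' \<alpha> B q h' X' Y' \<and> poly_growth sc br' X' Y' \<and>
    (\<forall>k i. singular_pair B q k i \<longrightarrow> br' (X' k) (X' i) = 0 \<and> br' (Y' k) (Y' i) = 0)"
proof -
  let ?hw = "homogeneous_word br T \<rho> q X Y"
  define WX where "WX = {u. \<exists>n. singular_word br B q X u n}"
  define WY where "WY = {u. \<exists>n. singular_word br B q Y u n}"
  define WK where "WK = WX \<union> WY"
  define WS where "WS = {u. \<exists>b. ?hw u b}"
  have WK_hw: "\<exists>b. ?hw u b" if "u \<in> WK" for u
  proof -
    from that consider n where "singular_word br B q X u n" | n where "singular_word br B q Y u n"
      by (auto simp: WK_def WX_def WY_def)
    then show ?thesis by cases (rule singular_word_homogeneous, assumption)+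
  qed
  have WS_par: "WS \<subseteq> par False \<union> par True"
  proof
    fix u assume "u \<in> WS"
    then obtain b where "?hw u b" by (auto simp: WS_def)
    then show "u \<in> par False \<union> par True" using homogeneous_word_par[of u b] by (cases b) simp_all
  qed
  have KS: "WK \<subseteq> WS" using WK_hw by (auto simp: WS_def)
  have spans: "span WX \<subseteq> span WK" "span WY \<subseteq> span WK" by (auto simp: WK_def intro!: span_mono)
  have extend: "br x u \<in> span WK" if "\<And>u. u \<in> WK \<Longrightarrow> br x u \<in> span WK" "u \<in> span WK" for x u
    using that(2)
  proof (induction rule: span_induct_alt)
    case (step k x y) then show ?case using that(1) by (simp add: br_simps span_add span_scale)
  qed (simp add: span_zero)
  have X_K: "br (X j) u \<in> span WK" if "u \<in> WK" for j u
    using that X_singular_word[of u _ j] singular_word.step[of br B q X u _ j] spans(2)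
    unfolding WK_def WX_def WY_def by (blast intro: span_base)
  have Y_K: "br (Y j) u \<in> span WK" if "u \<in> WK" for j u
    using that Y_singular_word[of u _ j] singular_word.step[of br B q Y u _ j] spans(1)
    unfolding WK_def WX_def WY_def by (blast intro: span_base)
  have \<rho>_K: "br (\<rho> t) u \<in> span WK" if "t \<in> T" "u \<in> WK" for t u
  proof -
    have "\<exists>c. br (\<rho> t) u = sc c u"
      using that singular_word_weight[OF _ \<rho>_even \<rho>_X]
        realization.singular_word_weight[OF dual, unfolded singular_word_dual, OF _ \<rho>_even \<rho>_Y]
      unfolding WK_def WX_def WY_def by blast
    then show ?thesis using that(2) by (metis span_base span_scale)
  qed
  \<comment> \<open>The super Jacobi identity reduces stability under the whole subalgebra to
    stability under its generators.\<close>
  have hw_K: "br x u \<in> span WK" if "?hw x b" "u \<in> span WK" for x b u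
    using that
  proof (induction arbitrary: u rule: homogeneous_word.induct)
    case (br x a w b)
    then show ?case
      unfolding jacobi_left[OF homogeneous_word_par[OF br(1)] homogeneous_word_par[OF br(2)]]
      by (intro span_diff span_scale) blast+
  qed (use extend X_K Y_K \<rho>_K in blast)+
  have ideal: "br x u \<in> span WK \<and> br u x \<in> span WK" if x: "x \<in> span WS" and u: "u \<in> span WK" for x u
    using x
  proof (induction rule: span_induct_alt)
    case base show ?case by (simp add: span_zero)
  next
    case (step k x y)
    from step(1) obtain a where x: "?hw x a" by (auto simp: WS_def)
    have "br u x \<in> span WK" using u
    proof (induction rule: span_induct_alt)
      case base show ?case by (simp add: span_zero)
    next
      case (step k u v)
      from WK_hw[OF step(1)] obtain b where "?hw u b" by blast
      then have "br u x = - sc (super_sign b a) (br x u)"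
        using skew homogeneous_word_par x by blast
      moreover have "br x u \<in> span WK" using hw_K[OF x span_base[OF step(1)]] .
      ultimately have "br u x \<in> span WK" by (simp add: span_neg span_scale)
      then show ?case using step(2) by (simp add: br_simps span_add span_scale)
    qed
    then show ?case using hw_K[OF x u] step(2) by (simp add: br_simps span_add span_scale)
  qed
  have closed: "br x y \<in> span WS" if x: "x \<in> span WS" and y: "y \<in> span WS" for x y
    using x
  proof (induction rule: span_induct_alt)
    case base show ?case by (simp add: span_zero)
  next
    case (step k x z)
    from step(1) obtain a where x: "?hw x a" by (auto simp: WS_def)
    have "br x y \<in> span WS" using y
    proof (induction rule: span_induct_alt)
      case base show ?case by (simp add: span_zero)
    next
      case (step k y z)
      then have "br x y \<in> WS" using homogeneous_word.br[OF x] by (auto simp: WS_def)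
      then show ?case using step(2) by (simp add: br_simps span_add span_scale span_base)
    qed
    then show ?case using step(2) by (simp add: br_simps span_add span_scale)
  qed
  have WK_par: "WK \<subseteq> par False \<union> par True" using KS WS_par by blast
  obtain \<pi> where lin: "Vector_Spaces.linear sc sc \<pi>"
    and ker: "\<And>v. v \<in> span WS \<Longrightarrow> \<pi> v = 0 \<longleftrightarrow> v \<in> span WK"
    and par: "\<And>b v. v \<in> par b \<Longrightarrow> \<pi> v \<in> par b"
    and super: "lie_super sc (\<lambda>x y. \<pi> (br (\<pi> x) (\<pi> y))) V0 V1"
    and hom: "\<And>x y. x \<in> span WS \<Longrightarrow> y \<in> span WS \<Longrightarrow> \<pi> (br (\<pi> (\<pi> x)) (\<pi> (\<pi> y))) = \<pi> (br x y)"
    using subquotient[OF WK_par WS_par span_mono[OF KS] closed ideal] by blast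
  interpret \<pi>: Vector_Spaces.linear sc sc \<pi> by fact
  let ?br = "\<lambda>x y. \<pi> (br (\<pi> x) (\<pi> y))"
  interpret Q: lie_super sc ?br V0 V1 by fact
  have X_S: "X i \<in> span WS" and Y_S: "Y i \<in> span WS" for i
    by (auto simp: WS_def intro!: span_base homogeneous_word.X homogeneous_word.Y)
  have \<rho>_S: "\<rho> t \<in> span WS" if "t \<in> T" for t
    using that by (auto simp: WS_def intro!: span_base homogeneous_word.\<rho>)
  have h_S: "h i \<in> span WS" for i using closed[OF X_S Y_S, of i i] by (simp add: X_Y)
  have K_nzw: "nzw u" if "u \<in> span WK" for u
    using that
  proof (induction rule: span_induct_alt)
    case base show ?case by (rule no_zero_weight.zero)
  next
    case (step k x y)
    then show ?case using singular_word_nzw by (auto simp: WK_def WX_def WY_def intro!: nzw_add nzw_scale)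
  qed
  have \<rho>_h: "br (\<rho> t) (h i) = 0" if "t \<in> T" for t i
    using jacobi_even[OF \<rho>_even[OF that], of "X i" "Y i"] that by (simp add: X_Y \<rho>_X \<rho>_Y br_simps)
  \<comment> \<open>Each \<open>h i\<close> commutes with every \<open>\<rho> t\<close>, which no
    nonzero vector of \<open>span WK\<close> does.\<close>
  have "h i \<notin> span WK" for i
    using nzw_weight_zero[OF K_nzw \<rho>_h] h_nonzero by blast
  then have h0: "\<pi> (h i) \<noteq> 0" for i using ker[OF h_S] by blast
  have "realization sc ?br V0 V1 T (\<pi> \<circ> \<rho>) \<alpha> B q (\<pi> \<circ> h) (\<pi> \<circ> X) (\<pi> \<circ> Y)"
  proof unfold_locales
    show "k i = 0" if "\<And>t. t \<in> T \<Longrightarrow> (\<Sum>i\<in>UNIV. k i * \<alpha> i t) = 0" for k i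
      using \<alpha>_independent that by blast
  qed (simp_all add: par \<rho>_even X_par Y_par hom \<rho>_S X_S Y_S h_S \<rho>_commute \<rho>_X \<rho>_Y X_Y h_X h_Y h0
      \<pi>.scale \<pi>.neg \<pi>.zero)
  moreover have "poly_growth sc ?br (\<pi> \<circ> X) (\<pi> \<circ> Y)"
  proof -
    \<comment> \<open>A word in the quotient is the image of the corresponding word in
      \<open>X\<close> and \<open>Y\<close>, of the same length, so the image of a spanning set
      serves for the quotient.\<close>
    have word: "\<exists>w. bracket_word br X Y w n \<and> u = \<pi> w" if "bracket_word ?br (\<pi> \<circ> X) (\<pi> \<circ> Y) u n" for u n
      using that
    proof (induction rule: bracket_word.induct)
      case (br u m w n)
      then obtain u' w' where uw: "bracket_word br X Y u' m" "u = \<pi> u'" "bracket_word br X Y w' n" "w = \<pi> w'"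
        by blast
      have "u' \<in> span WS" "w' \<in> span WS"
        using bracket_word_homogeneous[of br X Y] uw(1,3) by (auto simp: WS_def intro!: span_base)
      then show ?case using uw hom bracket_word.br by metis
    next
      case (X i) show ?case by (intro exI[of _ "X i"]) (simp only: bracket_word.X comp_apply)
    next
      case (Y i) show ?case by (intro exI[of _ "Y i"]) (simp only: bracket_word.Y comp_apply)
    qed
    obtain C d where Cd: "\<And>L. \<exists>B. finite B \<and> card B \<le> C * (1 + L) ^ d \<and>
        (\<forall>u n. bracket_word br X Y u n \<and> n \<le> L \<longrightarrow> u \<in> span B)"
      using growth unfolding poly_growth_def by blast
    have "\<exists>B. finite B \<and> card B \<le> C * (1 + L) ^ d \<and>
        (\<forall>u n. bracket_word ?br (\<pi> \<circ> X) (\<pi> \<circ> Y) u n \<and> n \<le> L \<longrightarrow> u \<in> span B)" for L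
    proof -
      obtain B where B: "finite B" "card B \<le> C * (1 + L) ^ d"
        "\<And>u n. bracket_word br X Y u n \<Longrightarrow> n \<le> L \<Longrightarrow> u \<in> span B"
        using Cd[of L] by meson
      have "u \<in> span (\<pi> ` B)" if un: "bracket_word ?br (\<pi> \<circ> X) (\<pi> \<circ> Y) u n" "n \<le> L" for u n
      proof -
        obtain w where w: "bracket_word br X Y w n" "u = \<pi> w" using word[OF un(1)] by blast
        show ?thesis unfolding w(2) \<pi>.span_image using B(3)[OF w(1) un(2)] by (rule imageI)
      qed
      moreover have "card (\<pi> ` B) \<le> C * (1 + L) ^ d"
        using card_image_le[OF B(1), of \<pi>] B(2) by (rule order_trans)
      ultimately show ?thesis using B(1) by blast
    qed
    then show ?thesis unfolding poly_growth_def by blast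
  qed
  moreover have "?br ((\<pi> \<circ> X) k) ((\<pi> \<circ> X) i) = 0 \<and> ?br ((\<pi> \<circ> Y) k) ((\<pi> \<circ> Y) i) = 0"
    if "singular_pair B q k i" for k i
  proof -
    have "br (X k) (X i) \<in> WX" "br (Y k) (Y i) \<in> WY"
      using singular_word.base[OF that] unfolding WX_def WY_def by blast+
    then have "br (X k) (X i) \<in> span WK" "br (Y k) (Y i) \<in> span WK"
      using spans by (blast intro: span_base)+
    then show ?thesis using ker[OF closed] by (simp add: hom X_S Y_S)
  qed
  ultimately show ?thesis by blast
qed

end

section \<open>Odd reflections\<close>

text \<open>For \<open>i \<noteq> k\<close>, either the entry in column \<open>k\<close> is nonzero,
  or \<open>a\<^sub>i\<^sub>k = 0\<close> and a nonzero entry of row \<open>i\<close> survives up to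
  a nonzero factor, or \<open>a\<^sub>k\<^sub>i = 0\<close> and row \<open>i\<close> turns into
  \<open>a\<^sub>i\<^sub>k\<close> times row \<open>k\<close>. The last case occurs when
  \<open>k\<close> is singular.\<close>

lemma elemental_odd_refl_mat:
  assumes el: "elemental B" and kk: "B k k = 0"
  shows "elemental (odd_refl_mat B k)"
  unfolding elemental_def
proof
  fix i
  obtain j where j: "B i j \<noteq> 0" using el unfolding elemental_def by blast
  obtain l where l: "B k l \<noteq> 0" using el unfolding elemental_def by blast
  consider "i = k" | "i \<noteq> k" "B i k \<noteq> 0" "B k i \<noteq> 0" | "i \<noteq> k" "B i k = 0" | "i \<noteq> k" "B i k \<noteq> 0" "B k i = 0"
    by blast
  then show "\<exists>j. odd_refl_mat B k i j \<noteq> 0"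
  proof cases
    case 1 then show ?thesis using l by (auto simp: odd_refl_mat_def)
  next
    case 2 then show ?thesis by (intro exI[of _ k]) (simp add: odd_refl_mat_def)
  next
    case 3 then show ?thesis using j by (intro exI[of _ j]) (auto simp: odd_refl_mat_def)
  next
    case 4 then show ?thesis using l kk by (intro exI[of _ l]) (auto simp: odd_refl_mat_def)
  qed
qed

locale odd_reflection = realization sc br V0 V1 T \<rho> \<alpha> B q h X Y
  for sc :: "complex \<Rightarrow> 'v::ab_group_add \<Rightarrow> 'v" and br V0 V1
    and T :: "'t set" and \<rho> \<alpha> and B :: "'i::finite \<Rightarrow> 'i \<Rightarrow> complex" and q h X Y +
  fixes k :: 'i
  assumes iso: "isotropic B q k"
    and reduced: "singular_pair B q j i \<Longrightarrow> br (X j) (X i) = 0 \<and> br (Y j) (Y i) = 0"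
begin

definition adj where "adj i \<longleftrightarrow> i \<noteq> k \<and> (B i k \<noteq> 0 \<or> B k i \<noteq> 0)"

definition X' where "X' i = (if i = k then Y k else if adj i then br (X k) (X i) else X i)"
text \<open>For neighbours, the factor cancels the sign from moving the odd \<open>X k\<close> past
  \<open>X i\<close>, so that \<open>[X' i, Y' i]\<close> is exactly \<open>h' i\<close>.\<close>

definition Y' where
  "Y' i = (if i = k then X k else if adj i then sc (super_sign True (q i)) (br (Y k) (Y i)) else Y i)"
definition h' where
  "h' i = (if adj i then sc (B k i) (h i) + sc (B i k) (h k) else h i)"
text \<open>Used twice: on the values of \<open>\<alpha>\<close> at \<open>t\<close> it gives the
  new functionals, and on the weights of \<open>h' i\<close> it gives row \<open>i\<close> of the
  reflected matrix.\<close>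

definition reflect :: "('i \<Rightarrow> complex) \<Rightarrow> 'i \<Rightarrow> complex" where
  "reflect \<mu> i = (if i = k then - \<mu> k else if adj i then \<mu> k + \<mu> i else \<mu> i)"

lemma kk: "B k k = 0" and qk: "q k"
  using iso by (simp_all add: isotropic_def)

lemma Xk: "X k \<in> par True" and Yk: "Y k \<in> par True"
  using X_par[of k] Y_par[of k] qk by simp_all

lemma X_X_0: "br (X k) (X k) = 0" and Y_Y_0: "br (Y k) (Y k) = 0"
  using reduced[of k k] iso by (simp_all add: singular_pair_def)

lemma not_adj: "i \<noteq> k \<Longrightarrow> \<not> adj i \<Longrightarrow> br (X k) (X i) = 0"
  "i \<noteq> k \<Longrightarrow> \<not> adj i \<Longrightarrow> br (Y k) (Y i) = 0"
  using reduced[of k i] by (simp_all add: singular_pair_def adj_def)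

lemma square_0: "br (X k) (br (X k) z) = 0" "br (Y k) (br (Y k) z) = 0"
  using br_square[OF Xk, of z] br_square[OF Yk, of z] X_X_0 Y_Y_0 by simp_all

lemma not_adj_k: "\<not> adj k" by (simp add: adj_def)

lemma weight:
  assumes z: "z \<in> par False" and zX: "\<And>j. br z (X j) = sc (\<mu> j) (X j)" and zY: "\<And>j. br z (Y j) = sc (- \<mu> j) (Y j)"
  shows "br z (X' i) = sc (reflect \<mu> i) (X' i)" and "br z (Y' i) = sc (- reflect \<mu> i) (Y' i)"
  unfolding X'_def Y'_def reflect_def
  by (simp_all add: zX zY br_simps jacobi_even[OF z] scale_left_distrib scale_left_diff_distrib
      scale_right_distrib scale_right_diff_distrib mult.commute algebra_simps)

lemma X_YY: "j \<noteq> k \<Longrightarrow> i \<noteq> k \<Longrightarrow>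
    br (X i) (br (Y k) (Y j)) = (if i = j then sc (super_sign True (q i) * B i k) (Y k) else 0)"
  and Xk_YY: "j \<noteq> k \<Longrightarrow> br (X k) (br (Y k) (Y j)) = - sc (B k j) (Y j)"
proof -
  have Yh: "br (Y k) (h i) = sc (B i k) (Y k)" for i
    using skew_even[OF h_even, of i "Y k"] h_Y by (simp add: minus_equation_iff)
  assume "j \<noteq> k"
  then show "br (X k) (br (Y k) (Y j)) = - sc (B k j) (Y j)"
    unfolding jacobi[OF Xk Yk] by (simp add: X_Y h_Y)
  assume "i \<noteq> k"
  with \<open>j \<noteq> k\<close> show "br (X i) (br (Y k) (Y j)) = (if i = j then sc (super_sign True (q i) * B i k) (Y k) else 0)"
    unfolding jacobi[OF X_par Yk] by (simp add: X_Y Yh super_sign_def)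
qed

text \<open>If exactly one index is \<open>k\<close>, then \<open>square_0\<close> and
  \<open>not_adj\<close> give zero; this is where the vanishing of the singular brackets enters. For
  two neighbours of \<open>k\<close>, Jacobi reduces the bracket to \<open>X_YY\<close> and
  \<open>Xk_YY\<close>.\<close>

lemma X'_Y': "br (X' i) (Y' j) = (if i = j then h' i else 0)"
proof -
  have sgn: "super_sign True b * super_sign True b = 1" for b by (simp add: super_sign_def)
  have YXk: "br (Y k) (X k) = h k" using Y_X[of k k] qk by (simp add: super_sign_def)
  have XXk: "br (X i) (X k) = - sc (super_sign (q i) True) (br (X k) (X i))" for i
    by (rule skew[OF X_par Xk])
  have XXX: "br (br (X k) (X i)) (X k) = 0" for i
    using skew[OF par_br[OF Xk X_par[of i]] Xk] square_0(1) by simp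
  have XX: "br (br (X k) (X i)) z = br (X k) (br (X i) z) - sc (super_sign True (q i)) (br (X i) (br (X k) z))" for i z
    by (rule jacobi_left[OF Xk X_par])
  show ?thesis
  proof (cases "i = k"; cases "j = k")
    assume "i = k" "j = k"
    then show ?thesis by (simp add: X'_def Y'_def h'_def YXk not_adj_k)
  next
    assume "i = k" "j \<noteq> k"
    then show ?thesis by (simp add: X'_def Y'_def br_scale_right square_0 not_adj)
  next
    assume "i \<noteq> k" "j = k"
    then show ?thesis by (simp add: X'_def Y'_def XXX XXk not_adj)
  next
    assume ij: "i \<noteq> k" "j \<noteq> k"
    then show ?thesis
    proof (cases "adj i"; cases "adj j")
      assume "adj i" "adj j"
      then have "br (X' i) (Y' j) = sc (super_sign True (q j)) (br (br (X k) (X i)) (br (Y k) (Y j)))"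
        using ij by (simp add: X'_def Y'_def br_scale_right)
      also have "br (br (X k) (X i)) (br (Y k) (Y j)) = (if i = j then sc (super_sign True (q i)) (h' i) else 0)"
        unfolding XX X_YY[OF ij(2,1)] Xk_YY[OF ij(2)] h'_def using \<open>adj i\<close> \<open>adj j\<close>
        by (cases "i = j") (simp_all add: br_simps X_Y scale_right_distrib)
      finally show ?thesis by (simp add: sgn)
    next
      assume "adj i" "\<not> adj j"
      moreover from this have "i \<noteq> j" by blast
      ultimately show ?thesis using ij unfolding X'_def Y'_def by (simp add: XX X_Y)
    next
      assume "\<not> adj i" "adj j"
      moreover from this have "i \<noteq> j" by blast
      ultimately show ?thesis using ij unfolding X'_def Y'_def by (simp add: br_scale_right X_YY)
    next
      assume "\<not> adj i" "\<not> adj j"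
      then show ?thesis using ij by (simp add: X'_def Y'_def h'_def X_Y)
    qed
  qed
qed

lemma h'_weight:
  shows "br (h' i) (X' j) = sc (odd_refl_mat B k i j) (X' j)"
    and "br (h' i) (Y' j) = sc (- odd_refl_mat B k i j) (Y' j)"
proof -
  define \<mu> where "\<mu> l = (if adj i then B k i * B i l + B i k * B k l else B i l)" for l
  have even: "h' i \<in> par False"
    unfolding h'_def by (auto intro!: subspace_add[OF subspace_par] subspace_scale[OF subspace_par] h_even)
  have hX: "br (h' i) (X l) = sc (\<mu> l) (X l)" for l
    unfolding h'_def \<mu>_def by (simp add: br_simps h_X scale_left_distrib)
  have hY: "br (h' i) (Y l) = sc (- \<mu> l) (Y l)" for l
    unfolding h'_def \<mu>_def by (simp add: br_simps h_Y scale_left_distrib scale_left_diff_distrib)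
  \<comment> \<open>As \<open>a\<^sub>k\<^sub>k = 0\<close>, for a neighbour \<open>i\<close> the
    element \<open>h' i\<close> acts on \<open>X k\<close> by
    \<open>a\<^sub>k\<^sub>i a\<^sub>i\<^sub>k\<close>. This is the extra summand in the entries at
    neighbours \<open>j\<close>, and its negative is the entry in column \<open>k\<close>.\<close>
  have "reflect \<mu> j = odd_refl_mat B k i j"
    unfolding reflect_def \<mu>_def odd_refl_mat_def adj_def by (auto simp: kk algebra_simps)
  then show "br (h' i) (X' j) = sc (odd_refl_mat B k i j) (X' j)"
    and "br (h' i) (Y' j) = sc (- odd_refl_mat B k i j) (Y' j)"
    using weight[OF even hX hY] by simp_all
qed

text \<open>For a neighbour \<open>j\<close>, bracketing \<open>[X\<^sub>k, X\<^sub>j]\<close> with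
  \<open>Y k\<close> and with \<open>Y j\<close> gives \<open>a\<^sub>k\<^sub>j X\<^sub>j\<close>
  and, up to sign, \<open>a\<^sub>j\<^sub>k X\<^sub>k\<close>, which are not both zero.\<close>

lemma X'_nonzero: "X' j \<noteq> 0"
proof (cases "adj j")
  case True
  then have j: "j \<noteq> k" by (simp add: adj_def)
  have "br (br (Y k) (X k)) (X j) = sc (B k j) (X j)"
    using Y_X[of k k] qk by (simp add: super_sign_def h_X)
  then have 1: "br (Y k) (br (X k) (X j)) = sc (B k j) (X j)"
    unfolding jacobi[OF Yk Xk] using j by (simp add: Y_X[of k j])
  have "br (X k) (h j) = - sc (B j k) (X k)"
    using skew_even[OF h_even, of j "X k"] h_X by (simp add: minus_equation_iff)
  then have 2: "br (Y j) (br (X k) (X j)) = sc (super_sign (q j) True * super_sign (q j) (q j) * B j k) (X k)"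
    unfolding jacobi[OF Y_par Xk] using j by (simp add: Y_X br_simps)
  show ?thesis
  proof
    assume "X' j = 0"
    then have "br (X k) (X j) = 0" using True j by (simp add: X'_def)
    with 1 2 have "B k j = 0" "B j k = 0" using X_nonzero by (simp_all add: super_sign_def split: if_splits)
    with True show False by (simp add: adj_def)
  qed
qed (simp add: X'_def X_nonzero Y_nonzero)

lemma reflect_independent:
  assumes "\<And>t. t \<in> T \<Longrightarrow> (\<Sum>i\<in>UNIV. c i * reflect (\<lambda>j. \<alpha> j t) i) = 0"
  shows "c i = 0"
proof -
  \<comment> \<open>\<open>e i\<close> is the coefficient of \<open>\<alpha> k\<close> in the
    reflected functional at \<open>i\<close>; \<open>d\<close> collects the coefficients once the
    combination is rewritten in the old functionals.\<close>
  define e where "e i = (if i = k then -1 else if adj i then 1 else 0 :: complex)" for i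
  define d where "d j = (if j = k then \<Sum>i\<in>UNIV. c i * e i else c j)" for j
  have "(\<Sum>j\<in>UNIV. d j * \<alpha> j t) = 0" if "t \<in> T" for t
  proof -
    have "(\<Sum>i\<in>UNIV. c i * reflect (\<lambda>j. \<alpha> j t) i) =
        (\<Sum>i\<in>UNIV. (if i = k then 0 else c i * \<alpha> i t) + c i * e i * \<alpha> k t)"
      by (rule sum.cong) (auto simp: reflect_def e_def algebra_simps)
    also have "\<dots> = (\<Sum>i\<in>UNIV. if i = k then 0 else c i * \<alpha> i t) + (\<Sum>i\<in>UNIV. c i * e i) * \<alpha> k t"
      by (simp add: sum.distrib sum_distrib_right)
    also have "\<dots> = (\<Sum>j\<in>UNIV. (if j = k then 0 else c j * \<alpha> j t) +
        (if j = k then (\<Sum>i\<in>UNIV. c i * e i) * \<alpha> j t else 0))"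
      by (simp add: sum.distrib)
    also have "\<dots> = (\<Sum>j\<in>UNIV. d j * \<alpha> j t)"
      by (rule sum.cong) (auto simp: d_def)
    finally show ?thesis using assms[OF that] by simp
  qed
  then have d: "d j = 0" for j using \<alpha>_independent by blast
  have c: "c j = 0" if "j \<noteq> k" for j using d[of j] that by (simp add: d_def)
  have "(\<Sum>i\<in>UNIV. c i * e i) = (\<Sum>i\<in>UNIV. if i = k then - c i else 0)"
    by (rule sum.cong) (auto simp: c e_def)
  then have "c k = 0" using d[of k] by (simp add: d_def)
  with c show ?thesis by metis
qed

theorem realization_reflected:
  assumes el: "elemental B"
  shows "realization sc br V0 V1 T \<rho> (\<lambda>i t. reflect (\<lambda>j. \<alpha> j t) i) (odd_refl_mat B k) (odd_refl_par B q k) h' X' Y'"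
proof unfold_locales
  show "X' i \<in> par (odd_refl_par B q k i)" for i
    using par_br[OF Xk X_par[of i]] Yk X_par[of i]
    by (simp add: X'_def odd_refl_par_def adj_def)
  show "Y' i \<in> par (odd_refl_par B q k i)" for i
    using par_br[OF Yk Y_par[of i]] Xk Y_par[of i]
    by (simp add: Y'_def odd_refl_par_def adj_def subspace_scale[OF subspace_par])
  show "c i = 0" if "\<And>t. t \<in> T \<Longrightarrow> (\<Sum>i\<in>UNIV. c i * reflect (\<lambda>j. \<alpha> j t) i) = 0" for c i
    using that by (rule reflect_independent)
  \<comment> \<open>Row \<open>i\<close> of the reflected matrix is nonzero, so \<open>h' i\<close>
    acts nontrivially on some \<open>X' j\<close>.\<close>
  show "h' i \<noteq> 0" for i
  proof
    assume "h' i = 0"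
    obtain j where "odd_refl_mat B k i j \<noteq> 0"
      using elemental_odd_refl_mat[of B k, OF el kk] unfolding elemental_def by blast
    then show False using h'_weight(1)[of i j] X'_nonzero[of j] \<open>h' i = 0\<close> by simp
  qed
qed (simp_all add: \<rho>_even \<rho>_commute X'_Y' h'_weight weight[OF \<rho>_even \<rho>_X \<rho>_Y])

text \<open>Up to a scalar every new generator is a word of length at most 2 in the old ones, so
  lengths at most double and the constant grows by \<open>2 ^ d\<close>.\<close>

lemma poly_growth_reflected:
  assumes "poly_growth sc br X Y"
  shows "poly_growth sc br X' Y'"
proof -
  have word: "\<exists>c w m. u = sc c w \<and> bracket_word br X Y w m \<and> m \<le> 2 * n" if "bracket_word br X' Y' u n" for u n
    using that
  proof (induction rule: bracket_word.induct)
    case (X i)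
    consider "i = k" | "i \<noteq> k" "adj i" | "i \<noteq> k" "\<not> adj i" by blast
    then show ?case
    proof cases
      case 1
      then show ?thesis using bracket_word.Y[of br X Y k]
        by (intro exI[of _ 1] exI[of _ "Y k"]) (auto simp: X'_def)
    next
      case 2
      then show ?thesis using bracket_word.br[OF bracket_word.X[of br X Y k] bracket_word.X[of br X Y i]]
        by (intro exI[of _ "1 :: complex"] exI[of _ "br (X k) (X i)"] exI[of _ "2 :: nat"])
          (auto simp: X'_def numeral_2_eq_2)
    next
      case 3
      then show ?thesis using bracket_word.X[of br X Y i]
        by (intro exI[of _ 1] exI[of _ "X i"]) (auto simp: X'_def)
    qed
  next
    case (Y i)
    consider "i = k" | "i \<noteq> k" "adj i" | "i \<noteq> k" "\<not> adj i" by blast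
    then show ?case
    proof cases
      case 1
      then show ?thesis using bracket_word.X[of br X Y k]
        by (intro exI[of _ 1] exI[of _ "X k"]) (auto simp: Y'_def)
    next
      case 2
      then show ?thesis using bracket_word.br[OF bracket_word.Y[of br X Y k] bracket_word.Y[of br X Y i]]
        by (intro exI[of _ "super_sign True (q i)"] exI[of _ "br (Y k) (Y i)"] exI[of _ "2 :: nat"])
          (auto simp: Y'_def numeral_2_eq_2)
    next
      case 3
      then show ?thesis using bracket_word.Y[of br X Y i]
        by (intro exI[of _ 1] exI[of _ "Y i"]) (auto simp: Y'_def)
    qed
  next
    case (br u m w n)
    then obtain c u' m' c' w' n' where
      "u = sc c u'" "bracket_word br X Y u' m'" "m' \<le> 2 * m"
      "w = sc c' w'" "bracket_word br X Y w' n'" "n' \<le> 2 * n" by blast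
    then show ?case
      using bracket_word.br[of br X Y u' m' w' n']
      by (intro exI[of _ "c * c'"] exI[of _ "br u' w'"] exI[of _ "m' + n'"]) (simp add: br_simps mult.commute)
  qed
  obtain C d where Cd: "\<And>L. \<exists>B. finite B \<and> card B \<le> C * (1 + L) ^ d \<and>
      (\<forall>u n. bracket_word br X Y u n \<and> n \<le> L \<longrightarrow> u \<in> span B)"
    using assms unfolding poly_growth_def by blast
  have "\<exists>B. finite B \<and> card B \<le> (C * 2 ^ d) * (1 + L) ^ d \<and>
      (\<forall>u n. bracket_word br X' Y' u n \<and> n \<le> L \<longrightarrow> u \<in> span B)" for L
  proof -
    obtain B where B: "finite B" "card B \<le> C * (1 + 2 * L) ^ d"
      "\<And>u n. bracket_word br X Y u n \<Longrightarrow> n \<le> 2 * L \<Longrightarrow> u \<in> span B"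
      using Cd[of "2 * L"] by meson
    have "C * (1 + 2 * L) ^ d \<le> C * (2 * (1 + L)) ^ d"
      by (intro mult_left_mono power_mono) simp_all
    then have "card B \<le> (C * 2 ^ d) * (1 + L) ^ d"
      using B(2) by (simp only: power_mult_distrib mult.assoc)
    moreover have "u \<in> span B" if u: "bracket_word br X' Y' u n" "n \<le> L" for u n
    proof -
      obtain c w m where w: "u = sc c w" "bracket_word br X Y w m" "m \<le> 2 * n" using word[OF u(1)] by blast
      then have "w \<in> span B" using B(3) u(2) by simp
      then show ?thesis using w(1) by (simp add: span_scale)
    qed
    ultimately show ?thesis using B(1) by blast
  qed
  then show ?thesis unfolding poly_growth_def by blast
qed

end

section \<open>From the contragredient superalgebra to realizations of all reflected
  matrices\<close>

lemma bracket_word_pdeg: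
  "bracket_word br X Y u n \<Longrightarrow> \<exists>m. has_pdeg br H X Y u m \<and> \<bar>m\<bar> \<le> int n"
proof (induction rule: bracket_word.induct)
  case (X i) show ?case using has_pdeg.posgen[of br H X Y i] by (intro exI[of _ 1]) simp
next
  case (Y i) show ?case using has_pdeg.neggen[of br H X Y i] by (intro exI[of _ "-1"]) simp
next
  case (br u m w n)
  then obtain a b where "has_pdeg br H X Y u a" "\<bar>a\<bar> \<le> int m" "has_pdeg br H X Y w b" "\<bar>b\<bar> \<le> int n" by blast
  then show ?case using has_pdeg.bracket[of br H X Y u a w b] by (intro exI[of _ "a + b"]) auto
qed

text \<open>A word of length at most \<open>L\<close> has a degree between \<open>- L\<close> and
  \<open>L\<close>, so the spanning sets of these \<open>2 L + 1\<close> graded pieces suffice;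
  summing over them raises the exponent by one.\<close>

lemma (in lie_super) finite_growth_imp_poly_growth:
  assumes "finite_growth sc br H X Y"
  shows "poly_growth sc br X Y"
proof -
  obtain C d where "\<forall>m. \<exists>B. finite B \<and> span B = graded_piece sc br H X Y m \<and> card B \<le> C * (1 + nat \<bar>m\<bar>) ^ d"
    using assms unfolding finite_growth_def by blast
  then obtain B where B: "\<And>m. finite (B m)" "\<And>m. span (B m) = graded_piece sc br H X Y m"
    "\<And>m. card (B m) \<le> C * (1 + nat \<bar>m\<bar>) ^ d" by metis
  have "\<exists>B. finite B \<and> card B \<le> (2 * C) * (1 + L) ^ Suc d \<and>
      (\<forall>u n. bracket_word br X Y u n \<and> n \<le> L \<longrightarrow> u \<in> span B)" for L
  proof (intro exI conjI allI impI)
    let ?B = "\<Union>m\<in>{-int L..int L}. B m"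
    show "finite ?B" using B(1) by simp
    have "card ?B \<le> (\<Sum>m\<in>{-int L..int L}. card (B m))" by (rule card_UN_le) simp
    also have "\<dots> \<le> (\<Sum>m\<in>{-int L..int L}. C * (1 + L) ^ d)"
    proof (rule sum_mono)
      fix m assume "m \<in> {-int L..int L}"
      then have "C * (1 + nat \<bar>m\<bar>) ^ d \<le> C * (1 + L) ^ d"
        by (intro mult_left_mono power_mono) auto
      then show "card (B m) \<le> C * (1 + L) ^ d" using B(3) order_trans by blast
    qed
    also have "\<dots> = (2 * L + 1) * (C * (1 + L) ^ d)" by (simp add: nat_add_distrib nat_mult_distrib)
    also have "\<dots> \<le> (2 * (1 + L)) * (C * (1 + L) ^ d)" by (intro mult_right_mono) simp_all
    finally show "card ?B \<le> (2 * C) * (1 + L) ^ Suc d" by (simp only: power_Suc mult_ac)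
    fix u n assume un: "bracket_word br X Y u n \<and> n \<le> L"
    then obtain m where m: "has_pdeg br H X Y u m" "\<bar>m\<bar> \<le> int n" using bracket_word_pdeg by metis
    then have "u \<in> span (B m)" unfolding B(2) graded_piece_def by (auto intro: span_base)
    moreover have "m \<in> {-int L..int L}" using m(2) un by auto
    ultimately show "u \<in> span ?B" using span_mono[of "B m" ?B] by blast
  qed
  then show ?thesis unfolding poly_growth_def by blast
qed

text \<open>The Cartan subalgebra serves as its own index set \<open>T\<close>. Each
  \<open>hh i\<close> is nonzero because some \<open>alpha j\<close> takes the nonzero value
  \<open>A i j\<close> on it.\<close>

lemma contragredient_realization:
  fixes A :: "'i::finite \<Rightarrow> 'i \<Rightarrow> complex"
  assumes el: "elemental A" and con: "contragredient_superalgebra A p sc br V0 V1 H alpha hh X Y"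
  shows "realization sc br V0 V1 H id alpha A p hh X Y"
proof -
  have lie: "lie_superalgebra sc br V0 V1" and HV: "H \<subseteq> V0" and sub: "module.subspace sc H"
    and lin: "\<forall>i. \<forall>x\<in>H. \<forall>y\<in>H. \<forall>c. alpha i (sc c x + y) = c * alpha i x + alpha i y"
    and ind: "\<forall>c :: 'i \<Rightarrow> complex. (\<forall>h\<in>H. (\<Sum>i\<in>UNIV. c i * alpha i h) = 0) \<longrightarrow> (\<forall>i. c i = 0)"
    and hhH: "\<forall>i. hh i \<in> H" and A: "\<forall>i j. alpha j (hh i) = A i j"
    and par: "\<forall>i. X i \<in> par_part V0 V1 (p i) \<and> Y i \<in> par_part V0 V1 (p i)"
    and HH: "\<forall>h\<in>H. \<forall>h'\<in>H. br h h' = 0"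
    and HX: "\<forall>h\<in>H. \<forall>i. br h (X i) = sc (alpha i h) (X i)"
    and HY: "\<forall>h\<in>H. \<forall>i. br h (Y i) = sc (- alpha i h) (Y i)"
    and XY: "\<forall>i j. br (X i) (Y j) = (if i = j then hh i else 0)"
    using con unfolding contragredient_superalgebra_def by - (elim conjE, assumption)+
  interpret lie_super sc br V0 V1 by (rule lie_super.intro) (rule lie)
  show ?thesis
  proof unfold_locales
    show "hh i \<noteq> 0" for i
    proof
      assume hh: "hh i = 0"
      obtain j where j: "A i j \<noteq> 0" using el unfolding elemental_def by blast
      have "0 \<in> H" using sub by (rule subspace_0)
      then have "alpha j (sc 1 0 + 0) = 1 * alpha j 0 + alpha j 0" using lin by blast
      then have "alpha j 0 = 0" by simp
      then show False using A j hh by metis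
    qed
    show "c i = 0" if "\<And>t. t \<in> H \<Longrightarrow> (\<Sum>i\<in>UNIV. c i * alpha i t) = 0" for c i
      using ind that by blast
    show "br (hh i) (X j) = sc (A i j) (X j)" "br (hh i) (Y j) = sc (- A i j) (Y j)" for i j
      using HX HY hhH A by metis+
  qed (use HV par HH HX HY XY in \<open>auto simp: par_part_def\<close>)
qed

text \<open>Each step first divides out the singular brackets and then reflects. The bracket,
  \<open>\<rho>\<close>, the functionals and the generators change on the way and are therefore
  existentially quantified, while the space, its parity decomposition and \<open>T\<close> stay
  fixed.\<close>

lemma odd_refl_reach_realization:
  assumes "odd_refl_reach A p A' p'" and "elemental A" and "poly_growth sc br X Y"
    and "realization sc br V0 V1 T \<rho> \<alpha> A p h X Y"
  shows "elemental A' \<and> (\<exists>br \<rho> \<alpha> h X Y. poly_growth sc br X Y \<and> realization sc br V0 V1 T \<rho> \<alpha> A' p' h X Y)"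
  using assms(1)
proof (induction rule: odd_refl_reach.induct)
  case refl
  then show ?case using assms(2-) by blast
next
  case (step B q k)
  from step.IH obtain br \<rho> \<alpha> h X Y
    where "poly_growth sc br X Y" "realization sc br V0 V1 T \<rho> \<alpha> B q h X Y" by auto
  then obtain br' \<rho>' h' X' Y' where R: "realization sc br' V0 V1 T \<rho>' \<alpha> B q h' X' Y'"
    and growth: "poly_growth sc br' X' Y'"
    and red: "\<And>k i. singular_pair B q k i \<Longrightarrow> br' (X' k) (X' i) = 0 \<and> br' (Y' k) (Y' i) = 0"
    using realization.reduced_quotient[of sc br V0 V1 T \<rho> \<alpha> B q h X Y] by metis
  interpret odd_reflection sc br' V0 V1 T \<rho>' \<alpha> B q h' X' Y' k
    using R step.hyps(2) red by (intro odd_reflection.intro odd_reflection_axioms.intro)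
  have el: "elemental B" using step.IH by (rule conjunct1)
  have "elemental (odd_refl_mat B k)" using el kk by (rule elemental_odd_refl_mat)
  with realization_reflected[OF el] poly_growth_reflected[OF growth] show ?case by blast
qed

theorem theorem4p6:
  fixes A :: "'i::finite \<Rightarrow> 'i \<Rightarrow> complex" and p :: "'i \<Rightarrow> bool"
    and sc :: "complex \<Rightarrow> 'v::ab_group_add \<Rightarrow> 'v" and br :: "'v \<Rightarrow> 'v \<Rightarrow> 'v"
    and V0 V1 H :: "'v set" and alpha :: "'i \<Rightarrow> 'v \<Rightarrow> complex"
    and hh X Y :: "'i \<Rightarrow> 'v"
  assumes "elemental A"
    and "contragredient_superalgebra A p sc br V0 V1 H alpha hh X Y"
    and "finite_growth sc br H X Y"
  shows "\<forall>A' p'. odd_refl_reach A p A' p' \<longrightarrow> satisfies_C1_C4_up_to_rows A' p'"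
proof (intro allI impI)
  fix A' p' assume reach: "odd_refl_reach A p A' p'"
  have R: "realization sc br V0 V1 H id alpha A p hh X Y"
    using assms(1,2) by (rule contragredient_realization)
  interpret realization sc br V0 V1 H id alpha A p hh X Y by (rule R)
  have "poly_growth sc br X Y" using assms(3) by (rule finite_growth_imp_poly_growth)
  from odd_refl_reach_realization[OF reach assms(1) this R]
  show "satisfies_C1_C4_up_to_rows A' p'" using realization.conds_of_poly_growth by blast
qed

end
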